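(* Let $\alpha\in\mathbb R$ and let $\kappa\in\mathbb N_0\cup\{+\infty\}$. Then: (a) $\mathcal K^{\ge,e}_{q,\kappa,\alpha}\subseteq\mathcal H^{\ge,e}_{q,\kappa}\subseteq\mathcal D_{q\times q,\kappa}\subseteq\tilde{\mathcal D}_{q\times q,\kappa}$. (b) $\mathcal K^{\ge}_{q,2\kappa,\alpha}\subseteq\mathcal H^{\ge}_{q,2\kappa}\subseteq\tilde{\mathcal D}_{q\times q,2\kappa}$. (c) $\mathcal K^{\ge,e}_{q,\kappa,\alpha}\subseteq\mathcal K^{\ge}_{q,\kappa,\alpha}\subseteq\tilde{\mathcal D}_{q\times q,\kappa}$. (d) $\mathcal K^{>}_{q,\kappa,\alpha}\cup\mathcal K^{\ge,cd}_{q,\kappa,\alpha}\subseteq\mathcal K^{\ge,e}_{q,\kappa,\alpha}$.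
   Context: Let $q\in\mathbb N=\{1,2,\dots\}$; $\mathbb N_0=\{0,1,2,\dots\}$. All sequences consist of complex $q\times q$ matrices; $(s_j)_{j=0}^{\infty}$ is indexed by $\mathbb N_0$, and $2\cdot\infty=\infty$. $A\ge0$ (resp. $A>0$) means that $A$ is nonnegative (resp. positive) Hermitian, i.e. Hermitian positive semidefinite (resp. definite); $A^\dagger$ is the Moore–Penrose inverse, $\mathcal N(A)$ the null space and $\mathcal R(A)$ the column space of $A$. Block Hankel matrices. For a sequence $(s_j)$ put $H_n=[s_{j+k}]_{j,k=0}^n$, $s_{\alpha,j}=-\alpha s_j+s_{j+1}$, and $H_{\alpha,n}=[s_{\alpha,j+k}]_{j,k=0}^n$ (whenever the entries are available). Put $L_0=s_0$ and, for $n\ge1$, $L_n=s_{2n}-[s_n,\dots,s_{2n-1}]\,H_{n-1}^\dagger\,\begin{bmatrix}s_n\\ \vdots\\ s_{2n-1}\end{bmatrix}$; let $L_{\alpha,n}$ be the matrix built in the same way from $(s_{\alpha,j})$ in place of $(s_j)$ (so $L_{\alpha,0}=s_{\alpha,0}$). Hankel classes. $\mathcal H^{\ge}_{q,2n}$: all $(s_j)_{j=0}^{2n}$ with $H_n\ge0$. $\mathcal H^{\ge}_{q,\infty}$: all $(s_j)_{j=0}^\infty$ with $(s_j)_{j=0}^{2n}\in\mathcal H^{\ge}_{q,2n}$ for all $n\in\mathbb N_0$. $\mathcal H^{\ge,e}_{q,2n}$: all $(s_j)_{j=0}^{2n}$ for which there are complex $q\times q$ matrices $s_{2n+1},s_{2n+2}$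 with $(s_j)_{j=0}^{2n+2}\in\mathcal H^{\ge}_{q,2n+2}$. $\mathcal H^{\ge,e}_{q,2n+1}$: all $(s_j)_{j=0}^{2n+1}$ for which there is a complex $q\times q$ matrix $s_{2n+2}$ with $(s_j)_{j=0}^{2n+2}\in\mathcal H^{\ge}_{q,2n+2}$. $\mathcal H^{\ge,e}_{q,\infty}=\mathcal H^{\ge}_{q,\infty}$. Stieltjes classes. $\mathcal K^{\ge}_{q,0,\alpha}$: all $(s_j)_{j=0}^0$ with $s_0\ge0$. For $n\ge1$, $\mathcal K^{\ge}_{q,2n,\alpha}$: all $(s_j)_{j=0}^{2n}$ with $H_n\ge0$ and $H_{\alpha,n-1}\ge0$. For $n\ge0$, $\mathcal K^{\ge}_{q,2n+1,\alpha}$: all $(s_j)_{j=0}^{2n+1}$ with $H_n\ge0$ and $H_{\alpha,n}\ge0$. $\mathcal K^{>}_{q,m,\alpha}$ is defined in the same way with $>0$ in place of $\ge0$ everywhere. $\mathcal K^{\ge}_{q,\infty,\alpha}$ (resp. $\mathcal K^{>}_{q,\infty,\alpha}$): all $(s_j)_{j=0}^\infty$ with $(s_j)_{j=0}^m\in\mathcal K^{\ge}_{q,m,\alpha}$ (resp. $\mathcal K^{>}_{q,m,\alpha}$) for all $m\in\mathbb N_0$. For $m\in\mathbb N_0$, $\mathcal K^{\ge,e}_{q,m,\alpha}$: all $(s_j)_{j=0}^m$ for which there is a complex $q\times q$ matrix $s_{m+1}$ with $(s_j)_{j=0}^{m+1}\in\mathcal K^{\ge}_{q,m+1,\alpha}$;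 $\mathcal K^{\ge,e}_{q,\infty,\alpha}=\mathcal K^{\ge}_{q,\infty,\alpha}$. For $n\ge0$, $\mathcal K^{\ge,cd}_{q,2n,\alpha}$: all $(s_j)_{j=0}^{2n}\in\mathcal K^{\ge}_{q,2n,\alpha}$ with $L_n=0$; $\mathcal K^{\ge,cd}_{q,2n+1,\alpha}$: all $(s_j)_{j=0}^{2n+1}\in\mathcal K^{\ge}_{q,2n+1,\alpha}$ with $L_{\alpha,n}=0$; $\mathcal K^{\ge,cd}_{q,\infty,\alpha}$: all $(s_j)_{j=0}^\infty\in\mathcal K^{\ge}_{q,\infty,\alpha}$ for which there is $m\in\mathbb N_0$ with $(s_j)_{j=0}^m\in\mathcal K^{\ge,cd}_{q,m,\alpha}$. First term domination. $\mathcal D_{q\times q,\kappa}$: all $(s_j)_{j=0}^\kappa$ with $\mathcal N(s_0)\subseteq\mathcal N(s_j)$ and $\mathcal R(s_j)\subseteq\mathcal R(s_0)$ for all $0\le j\le\kappa$ ($j$ an integer). For $m\in\mathbb N$, $\tilde{\mathcal D}_{q\times q,m}$: all $(s_j)_{j=0}^m$ with $(s_j)_{j=0}^{m-1}\in\mathcal D_{q\times q,m-1}$; $\tilde{\mathcal D}_{q\times q,0}=\mathcal D_{q\times q,0}$ and $\tilde{\mathcal D}_{q\times q,\infty}=\mathcal D_{q\times q,\infty}$. *)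

theory Defs
  imports
    "Jordan_Normal_Form.Matrix_Kernel"
    "Jordan_Normal_Form.Schur_Decomposition"
    "HOL-Library.Extended_Nat"
    "HOL-Library.FuncSet"
begin

section \<open>Matrices\<close>

definition nonneg_hermitian :: "complex mat \<Rightarrow> bool" where
  "nonneg_hermitian A \<longleftrightarrow>
     square_mat A \<and> mat_adjoint A = A \<and>
     (\<forall>v \<in> carrier_vec (dim_row A). 0 \<le> Re ((A *\<^sub>v v) \<bullet>c v))"

definition pos_hermitian :: "complex mat \<Rightarrow> bool" where
  "pos_hermitian A \<longleftrightarrow>
     square_mat A \<and> mat_adjoint A = A \<and>
     (\<forall>v \<in> carrier_vec (dim_row A). v \<noteq> 0\<^sub>v (dim_row A) \<longrightarrow> 0 < Re ((A *\<^sub>v v) \<bullet>c v))"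

text \<open>The Moore--Penrose inverse: the unique solution of the four Penrose equations.\<close>

definition pseudo_inverse :: "complex mat \<Rightarrow> complex mat" where
  "pseudo_inverse A =
     (THE X. X \<in> carrier_mat (dim_col A) (dim_row A) \<and>
        A * X * A = A \<and> X * A * X = X \<and>
        mat_adjoint (A * X) = A * X \<and> mat_adjoint (X * A) = X * A)"

text \<open>The \<open>m \<times> n\<close> block matrix whose block in block row \<open>i\<close> and block column \<open>j\<close>
  (counted from 0) is the \<open>q \<times> q\<close> matrix \<open>F i j\<close>.\<close>

definition block_mat :: "nat \<Rightarrow> nat \<Rightarrow> nat \<Rightarrow> (nat \<Rightarrow> nat \<Rightarrow> complex mat) \<Rightarrow> complex mat" where
  "block_mat q m n F =
     mat (m * q) (n * q) (\<lambda>(i, j). F (i div q) (j div q) $$ (i mod q, j mod q))"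


section \<open>Sequences of matrices\<close>

text \<open>A sequence \<open>(s\<^sub>j)\<close> with \<open>0 \<le> j \<le> \<kappa>\<close> is an extensional function on \<open>{j. enat j \<le> \<kappa>}\<close>.
  Hence \<open>restrict s {..m}\<close> is the truncated sequence with last index \<open>m\<close>, and
  \<open>s(Suc m := A)\<close> appends \<open>A\<close> to a sequence with last index \<open>m\<close>.\<close>

definition mat_seqs :: "nat \<Rightarrow> enat \<Rightarrow> (nat \<Rightarrow> complex mat) set" where
  "mat_seqs q \<kappa> = PiE {j. enat j \<le> \<kappa>} (\<lambda>_. carrier_mat q q)"

text \<open>The sequence \<open>s\<^bsub>\<alpha>,j\<^esub> = - \<alpha> s\<^sub>j + s\<^bsub>j+1\<^esub>\<close>; it is only ever evaluated at indices \<open>j\<close> for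
  which \<open>s\<close> is available at \<open>j + 1\<close>.\<close>

definition shift_seq :: "real \<Rightarrow> (nat \<Rightarrow> complex mat) \<Rightarrow> nat \<Rightarrow> complex mat" where
  "shift_seq \<alpha> s j = (- complex_of_real \<alpha>) \<cdot>\<^sub>m s j + s (Suc j)"

definition block_hankel :: "nat \<Rightarrow> (nat \<Rightarrow> complex mat) \<Rightarrow> nat \<Rightarrow> complex mat" where
  "block_hankel q s n = block_mat q (Suc n) (Suc n) (\<lambda>j k. s (j + k))"

definition hankel_schur :: "nat \<Rightarrow> (nat \<Rightarrow> complex mat) \<Rightarrow> nat \<Rightarrow> complex mat" where
  "hankel_schur q s n =
     (if n = 0 then s 0
      else s (2 * n) -
        block_mat q 1 n (\<lambda>_ k. s (n + k)) *
        pseudo_inverse (block_hankel q s (n - 1)) *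
        block_mat q n 1 (\<lambda>j _. s (n + j)))"


section \<open>Hankel classes\<close>

text \<open>Subscripts are last indices, as in \<open>\<H>\<^bsub>q,2n\<^esub>\<close>. The class \<open>\<H>\<^bsub>q,m\<^esub>\<close> exists for even \<open>m\<close> only;
  for odd \<open>m\<close> the set below is empty by convention.\<close>

definition hankel_fin :: "nat \<Rightarrow> nat \<Rightarrow> (nat \<Rightarrow> complex mat) set" where
  "hankel_fin q m =
     {s \<in> mat_seqs q (enat m). even m \<and> nonneg_hermitian (block_hankel q s (m div 2))}"

definition hankel :: "nat \<Rightarrow> enat \<Rightarrow> (nat \<Rightarrow> complex mat) set" where
  "hankel q \<kappa> =
     (case \<kappa> of
        enat m \<Rightarrow> hankel_fin q m
      | \<infinity> \<Rightarrow> {s \<in> mat_seqs q \<infinity>. \<forall>n. restrict s {..2 * n} \<in> hankel_fin q (2 * n)})"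

definition hankel_ext :: "nat \<Rightarrow> enat \<Rightarrow> (nat \<Rightarrow> complex mat) set" where
  "hankel_ext q \<kappa> =
     (case \<kappa> of
        enat m \<Rightarrow>
          (if even m
           then {s \<in> mat_seqs q (enat m). \<exists>A \<in> carrier_mat q q. \<exists>B \<in> carrier_mat q q.
                   s(m + 1 := A, m + 2 := B) \<in> hankel_fin q (m + 2)}
           else {s \<in> mat_seqs q (enat m). \<exists>A \<in> carrier_mat q q.
                   s(m + 1 := A) \<in> hankel_fin q (m + 1)})
      | \<infinity> \<Rightarrow> hankel q \<infinity>)"


section \<open>Stieltjes classes\<close>

text \<open>The predicate \<open>P\<close> is \<^const>\<open>nonneg_hermitian\<close> for the classes \<open>\<K>\<^sup>\<ge>\<close> and \<^const>\<open>pos_hermitian\<close>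
  for the classes \<open>\<K>\<^sup>>\<close>.\<close>

definition stieltjes_fin ::
  "(complex mat \<Rightarrow> bool) \<Rightarrow> nat \<Rightarrow> real \<Rightarrow> nat \<Rightarrow> (nat \<Rightarrow> complex mat) set" where
  "stieltjes_fin P q \<alpha> m =
     {s \<in> mat_seqs q (enat m).
        if m = 0 then P (s 0)
        else if even m then
          P (block_hankel q s (m div 2)) \<and> P (block_hankel q (shift_seq \<alpha> s) (m div 2 - 1))
        else
          P (block_hankel q s (m div 2)) \<and> P (block_hankel q (shift_seq \<alpha> s) (m div 2))}"

definition stieltjes ::
  "(complex mat \<Rightarrow> bool) \<Rightarrow> nat \<Rightarrow> real \<Rightarrow> enat \<Rightarrow> (nat \<Rightarrow> complex mat) set" where
  "stieltjes P q \<alpha> \<kappa> =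
     (case \<kappa> of
        enat m \<Rightarrow> stieltjes_fin P q \<alpha> m
      | \<infinity> \<Rightarrow> {s \<in> mat_seqs q \<infinity>. \<forall>m. restrict s {..m} \<in> stieltjes_fin P q \<alpha> m})"

abbreviation stieltjes_nonneg :: "nat \<Rightarrow> real \<Rightarrow> enat \<Rightarrow> (nat \<Rightarrow> complex mat) set" where
  "stieltjes_nonneg \<equiv> stieltjes nonneg_hermitian"

abbreviation stieltjes_pos :: "nat \<Rightarrow> real \<Rightarrow> enat \<Rightarrow> (nat \<Rightarrow> complex mat) set" where
  "stieltjes_pos \<equiv> stieltjes pos_hermitian"

definition stieltjes_ext :: "nat \<Rightarrow> real \<Rightarrow> enat \<Rightarrow> (nat \<Rightarrow> complex mat) set" where
  "stieltjes_ext q \<alpha> \<kappa> =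
     (case \<kappa> of
        enat m \<Rightarrow> {s \<in> mat_seqs q (enat m). \<exists>A \<in> carrier_mat q q.
                     s(m + 1 := A) \<in> stieltjes_nonneg q \<alpha> (enat (m + 1))}
      | \<infinity> \<Rightarrow> stieltjes_nonneg q \<alpha> \<infinity>)"

text \<open>Completely degenerate sequences.\<close>

definition stieltjes_cd_fin :: "nat \<Rightarrow> real \<Rightarrow> nat \<Rightarrow> (nat \<Rightarrow> complex mat) set" where
  "stieltjes_cd_fin q \<alpha> m =
     {s \<in> stieltjes_nonneg q \<alpha> (enat m).
        hankel_schur q (if even m then s else shift_seq \<alpha> s) (m div 2) = 0\<^sub>m q q}"

definition stieltjes_cd :: "nat \<Rightarrow> real \<Rightarrow> enat \<Rightarrow> (nat \<Rightarrow> complex mat) set" where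
  "stieltjes_cd q \<alpha> \<kappa> =
     (case \<kappa> of
        enat m \<Rightarrow> stieltjes_cd_fin q \<alpha> m
      | \<infinity> \<Rightarrow> {s \<in> stieltjes_nonneg q \<alpha> \<infinity>. \<exists>m. restrict s {..m} \<in> stieltjes_cd_fin q \<alpha> m})"


section \<open>First term domination\<close>

definition first_dom :: "nat \<Rightarrow> enat \<Rightarrow> (nat \<Rightarrow> complex mat) set" where
  "first_dom q \<kappa> =
     {s \<in> mat_seqs q \<kappa>. \<forall>j. enat j \<le> \<kappa> \<longrightarrow>
        mat_kernel (s 0) \<subseteq> mat_kernel (s j) \<and>
        vec_space.col_space q (s j) \<subseteq> vec_space.col_space q (s 0)}"

text \<open>Domination of all terms except possibly the last one.\<close>

definition first_dom_but_last :: "nat \<Rightarrow> enat \<Rightarrow> (nat \<Rightarrow> complex mat) set" where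
  "first_dom_but_last q \<kappa> =
     (case \<kappa> of
        enat m \<Rightarrow>
          (if m = 0 then first_dom q 0
           else {s \<in> mat_seqs q (enat m). restrict s {..m - 1} \<in> first_dom q (enat (m - 1))})
      | \<infinity> \<Rightarrow> first_dom q \<infinity>)"

end

theory Submission
  imports Defs
begin

text \<open>All four parts rest on a few facts about a nonnegative Hermitian matrix \<open>H\<close>: an isotropic vector
  of \<open>H\<close> is a null vector (\<open>psd_on_kernel\<close>), hence every off-diagonal block column is in the range
  of the diagonal block beside it (\<open>psd_on_block_range\<close>); conversely, if a new column \<open>z = H X\<close>
  is in the range, then bordering \<open>H\<close> by \<open>z\<close> and the corner \<open>X\<^sup>* H X\<close> keeps it nonnegative
  (\<open>hankel_psd_extend\<close>).

  Domination. If \<open>s\<^sub>0 v = 0\<close>, placing \<open>v\<close> into the first block of a vector gives an isotropic vector of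
  the block Hankel matrix, so \<open>s\<^sub>j v = 0\<close> for the terms of the first block row. Now \<open>v\<close> may be
  placed into the next block, and so on, until all terms but the last are reached
  (\<open>hankel_psd_kernel_dominated\<close>). An extension of the sequence turns the last
  term into an inner one. For a Stieltjes sequence with odd last index \<open>2n + 1\<close>, the term \<open>s\<^bsub>2n\<^esub>\<close> is
  reached through the shifted sequence \<open>s\<^bsub>\<alpha>,j\<^esub>\<close> (\<open>stieltjes_psd_dominated\<close>). The range inclusions
  follow from those of the null spaces because all terms concerned are Hermitian.

  Extension. To extend a Stieltjes sequence by one term, the Hankel matrix of either \<open>s\<close> (odd last
  index) or the shifted sequence (even last index) has to be enlarged by one block, and only the
  range condition \<open>hankel_col_dep q n n\<close> for its next block column is in question. For positive
  definite matrices it is trivial. In the completely degenerate case, a vanishing Schur complement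
  expresses the last block column of one of the two Hankel matrices by the earlier ones,
  in all its rows (\<open>hankel_col_dep_schur_0\<close>). Such a relation for \<open>s\<close> implies one for the shifted
  sequence and conversely (\<open>hankel_col_dep_shift\<close>, \<open>hankel_col_dep_unshift\<close>), and so it gives
  the range condition for the other Hankel matrix, which is the one that has to be enlarged.

  The remaining point is that an extendable Stieltjes sequence \<open>s\<^sub>0, \<dots>, s\<^bsub>2n\<^esub>\<close> is Hankel extendable. Its
  Stieltjes extension \<open>s\<^bsub>2n+1\<^esub>\<close> may have no further nonnegative Hankel extension, but it can
  be replaced by the completely degenerate one, and the previous paragraph then supplies
  \<open>s\<^bsub>2n+2\<^esub>\<close> (\<open>hankel_extend_of_stieltjes\<close>).\<close>

section \<open>Linear algebra over finite index sets\<close>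

definition sesq :: "'i set \<Rightarrow> ('i \<Rightarrow> 'i \<Rightarrow> complex) \<Rightarrow> ('i \<Rightarrow> complex) \<Rightarrow> ('i \<Rightarrow> complex) \<Rightarrow> complex" where
  "sesq I F x y = (\<Sum>i\<in>I. \<Sum>j\<in>I. cnj (x i) * F i j * y j)"

definition psd_on :: "'i set \<Rightarrow> ('i \<Rightarrow> 'i \<Rightarrow> complex) \<Rightarrow> bool" where
  "psd_on I F \<longleftrightarrow> (\<forall>i\<in>I. \<forall>j\<in>I. F j i = cnj (F i j)) \<and> (\<forall>x. 0 \<le> Re (sesq I F x x))"

lemma psd_on_hermitian: "psd_on I F \<Longrightarrow> i \<in> I \<Longrightarrow> j \<in> I \<Longrightarrow> F j i = cnj (F i j)"
  unfolding psd_on_def by blast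

lemma psd_on_nonneg: "psd_on I F \<Longrightarrow> 0 \<le> Re (sesq I F x x)"
  unfolding psd_on_def by blast

text \<open>The single source of solutions of linear equations in what follows: \<open>F y = z\<close> is solvable if
  \<open>z\<close> is annihilated by everything that annihilates the columns of \<open>F\<close>. Induction on the set of
  columns: if some \<open>w0\<close> annihilates all columns except the new one, it determines the new
  coordinate of \<open>y\<close>; otherwise the new column is redundant.\<close>

lemma fredholm_alternative:
  fixes F :: "'i \<Rightarrow> 'j \<Rightarrow> complex" and z :: "'i \<Rightarrow> complex"
  assumes "finite J" "finite I"
    and "\<And>w. (\<And>j. j \<in> J \<Longrightarrow> (\<Sum>i\<in>I. w i * F i j) = 0) \<Longrightarrow> (\<Sum>i\<in>I. w i * z i) = 0"
  shows "\<exists>y. \<forall>i\<in>I. (\<Sum>j\<in>J. F i j * y j) = z i"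
  using assms(1,3)
proof (induction J arbitrary: z rule: finite_induct)
  case empty
  have "z k = 0" if "k \<in> I" for k
    using empty.prems[of "\<lambda>i. if i = k then 1 else 0"] that \<open>finite I\<close>
    by (simp add: if_distrib[of "\<lambda>c. c * _"] cong: if_cong)
  then show ?case by simp
next
  case (insert l J)
  define pair where "pair w u = (\<Sum>i\<in>I. w i * u i)" for w u :: "'i \<Rightarrow> complex"
  show ?case
  proof (cases "\<forall>w. (\<forall>j\<in>J. pair w (\<lambda>i. F i j) = 0) \<longrightarrow> pair w (\<lambda>i. F i l) = 0")
    case True
    have "\<exists>y. \<forall>i\<in>I. (\<Sum>j\<in>J. F i j * y j) = z i"
      by (rule insert.IH, rule insert.prems) (use True in \<open>auto simp: pair_def\<close>)
    then obtain y where y: "\<forall>i\<in>I. (\<Sum>j\<in>J. F i j * y j) = z i" by blast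
    have "(\<Sum>j\<in>insert l J. F i j * (y(l := 0)) j) = z i" if "i \<in> I" for i
    proof -
      have "(\<Sum>j\<in>J. F i j * (y(l := 0)) j) = (\<Sum>j\<in>J. F i j * y j)"
        by (rule sum.cong) (use insert.hyps in auto)
      then show ?thesis using insert.hyps y that by simp
    qed
    then show ?thesis by blast
  next
    case False
    then obtain w0 where w0: "\<And>j. j \<in> J \<Longrightarrow> pair w0 (\<lambda>i. F i j) = 0"
      and ne: "pair w0 (\<lambda>i. F i l) \<noteq> 0" by blast
    \<comment> \<open>Pairing with \<open>w0\<close> forces the value of the coordinate \<open>l\<close> of a solution.\<close>
    define c where "c = pair w0 z / pair w0 (\<lambda>i. F i l)"
    have "\<exists>y. \<forall>i\<in>I. (\<Sum>j\<in>J. F i j * y j) = z i - c * F i l"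
    proof (rule insert.IH)
      fix w assume w: "\<And>j. j \<in> J \<Longrightarrow> (\<Sum>i\<in>I. w i * F i j) = 0"
      define t where "t = pair w (\<lambda>i. F i l) / pair w0 (\<lambda>i. F i l)"
      have lin: "(\<Sum>i\<in>I. (w i - t * w0 i) * u i) = pair w u - t * pair w0 u" for u
        by (simp add: pair_def sum_subtractf sum_distrib_left algebra_simps)
      have "(\<Sum>i\<in>I. (w i - t * w0 i) * z i) = 0"
      proof (rule insert.prems)
        fix j assume "j \<in> insert l J"
        then show "(\<Sum>i\<in>I. (w i - t * w0 i) * F i j) = 0"
          unfolding lin using w w0 ne by (auto simp: pair_def t_def)
      qed
      then have "pair w z = t * pair w0 z" unfolding lin by simp
      also have "\<dots> = c * pair w (\<lambda>i. F i l)" by (simp add: t_def c_def)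
      finally show "(\<Sum>i\<in>I. w i * (z i - c * F i l)) = 0"
        by (simp add: pair_def sum_subtractf sum_distrib_left algebra_simps)
    qed
    then obtain y where y: "\<forall>i\<in>I. (\<Sum>j\<in>J. F i j * y j) = z i - c * F i l" by blast
    have "(\<Sum>j\<in>insert l J. F i j * (y(l := c)) j) = z i" if "i \<in> I" for i
    proof -
      have "(\<Sum>j\<in>J. F i j * (y(l := c)) j) = (\<Sum>j\<in>J. F i j * y j)"
        by (rule sum.cong) (use insert.hyps in auto)
      then show ?thesis using insert.hyps y that by simp
    qed
    then show ?thesis by blast
  qed
qed

lemma sesq_cong:
  assumes "\<And>i j. i \<in> I \<Longrightarrow> j \<in> I \<Longrightarrow> F i j = G i j"
  shows "sesq I F x y = sesq I G x y"
  unfolding sesq_def by (intro sum.cong refl) (use assms in auto)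

lemma psd_on_cong:
  assumes "\<And>i j. i \<in> I \<Longrightarrow> j \<in> I \<Longrightarrow> F i j = G i j"
  shows "psd_on I F \<longleftrightarrow> psd_on I G"
proof -
  have "(\<forall>i\<in>I. \<forall>j\<in>I. F j i = cnj (F i j)) \<longleftrightarrow> (\<forall>i\<in>I. \<forall>j\<in>I. G j i = cnj (G i j))"
    by (intro ball_cong refl) (simp only: assms)
  then show ?thesis using sesq_cong[of I F G] assms unfolding psd_on_def by presburger
qed

text \<open>Congruence \<open>T\<^sup>* F T\<close> preserves nonnegativity. Restricting, reindexing and enlarging a
  nonnegative matrix are all instances, for different choices of \<open>T\<close>.\<close>

lemma psd_on_pullback:
  assumes "psd_on I F" "finite I" "finite P"
  shows "psd_on P (\<lambda>p r. \<Sum>i\<in>I. \<Sum>k\<in>I. cnj (T i p) * F i k * T k r)"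
  unfolding psd_on_def
proof (intro conjI ballI allI)
  fix p r assume "p \<in> P" "r \<in> P"
  have "cnj (\<Sum>i\<in>I. \<Sum>k\<in>I. cnj (T i p) * F i k * T k r) = (\<Sum>i\<in>I. \<Sum>k\<in>I. cnj (T k r) * F k i * T i p)"
    unfolding cnj_sum
  proof (intro sum.cong refl)
    fix i k assume "i \<in> I" "k \<in> I"
    then show "cnj (cnj (T i p) * F i k * T k r) = cnj (T k r) * F k i * T i p"
      using psd_on_hermitian[OF assms(1), of i k] by (simp add: mult_ac)
  qed
  also have "\<dots> = (\<Sum>i\<in>I. \<Sum>k\<in>I. cnj (T i r) * F i k * T k p)" by (rule sum.swap)
  finally show "(\<Sum>i\<in>I. \<Sum>k\<in>I. cnj (T i r) * F i k * T k p)
      = cnj (\<Sum>i\<in>I. \<Sum>k\<in>I. cnj (T i p) * F i k * T k r)" by simp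
next
  fix x
  have "sesq P (\<lambda>p r. \<Sum>i\<in>I. \<Sum>k\<in>I. cnj (T i p) * F i k * T k r) x x
    = (\<Sum>p\<in>P. \<Sum>r\<in>P. \<Sum>i\<in>I. \<Sum>k\<in>I. cnj (T i p * x p) * F i k * (T k r * x r))"
    unfolding sesq_def by (simp add: sum_distrib_left sum_distrib_right mult_ac)
  also have "\<dots> = (\<Sum>p\<in>P. \<Sum>i\<in>I. \<Sum>r\<in>P. \<Sum>k\<in>I. cnj (T i p * x p) * F i k * (T k r * x r))"
    by (intro sum.cong refl sum.swap)
  also have "\<dots> = (\<Sum>i\<in>I. \<Sum>p\<in>P. \<Sum>r\<in>P. \<Sum>k\<in>I. cnj (T i p * x p) * F i k * (T k r * x r))"
    by (rule sum.swap)
  also have "\<dots> = (\<Sum>i\<in>I. \<Sum>p\<in>P. \<Sum>k\<in>I. \<Sum>r\<in>P. cnj (T i p * x p) * F i k * (T k r * x r))"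
    by (intro sum.cong refl sum.swap)
  also have "\<dots> = (\<Sum>i\<in>I. \<Sum>k\<in>I. \<Sum>p\<in>P. \<Sum>r\<in>P. cnj (T i p * x p) * F i k * (T k r * x r))"
    by (intro sum.cong refl sum.swap)
  also have "\<dots> = sesq I F (\<lambda>i. \<Sum>p\<in>P. T i p * x p) (\<lambda>i. \<Sum>p\<in>P. T i p * x p)"
    unfolding sesq_def
    by (intro sum.cong refl, subst sum.swap) (simp add: sum_distrib_left sum_distrib_right)
  finally show "0 \<le> Re (sesq P (\<lambda>p r. \<Sum>i\<in>I. \<Sum>k\<in>I. cnj (T i p) * F i k * T k r) x x)"
    using psd_on_nonneg[OF assms(1)] by simp
qed

lemma psd_on_reindex:
  assumes "psd_on I F" "finite I" "finite P" "h ` P \<subseteq> I"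
  shows "psd_on P (\<lambda>p r. F (h p) (h r))"
proof -
  have "psd_on P (\<lambda>p r. \<Sum>i\<in>I. \<Sum>k\<in>I. cnj (if i = h p then 1 else 0) * F i k * (if k = h r then 1 else 0))"
    by (rule psd_on_pullback) (use assms in auto)
  moreover have "(\<Sum>i\<in>I. \<Sum>k\<in>I. cnj (if i = h p then 1 else 0) * F i k * (if k = h r then 1 else 0)) = F (h p) (h r)"
    if "p \<in> P" "r \<in> P" for p r
  proof -
    have "h p \<in> I" "h r \<in> I" using that assms by auto
    moreover have "(\<Sum>k\<in>I. cnj (if i = h p then 1 else 0) * F i k * (if k = h r then 1 else 0)) 
        = (if i = h p then F i (h r) else 0)" for i
      using \<open>h r \<in> I\<close> \<open>finite I\<close> by (simp add: if_distrib[of "\<lambda>c. _ * c"] cong: if_cong)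
    ultimately show ?thesis using \<open>finite I\<close> by simp
  qed
  ultimately show ?thesis by (rule psd_on_cong[THEN iffD1, rotated])
qed

lemma psd_on_subset: "psd_on I F \<Longrightarrow> finite I \<Longrightarrow> J \<subseteq> I \<Longrightarrow> psd_on J F"
  using psd_on_reindex[of I F J "\<lambda>i. i"] finite_subset by auto

text \<open>Otherwise the form would become negative at \<open>x + t F x\<close> for small \<open>t < 0\<close>: its derivative
  at \<open>t = 0\<close> is twice the squared norm of \<open>F x\<close>.\<close>

lemma psd_on_kernel:
  assumes psd: "psd_on I F" and "finite I" and zero: "sesq I F x x = 0" and "i \<in> I"
  shows "(\<Sum>j\<in>I. F i j * x j) = 0"
proof (rule ccontr)
  assume ne: "(\<Sum>j\<in>I. F i j * x j) \<noteq> 0"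
  define y where "y i = (\<Sum>j\<in>I. F i j * x j)" for i
  define N where "N = (\<Sum>i\<in>I. (cmod (y i))\<^sup>2)"
  have yx: "sesq I F y x = of_real N"
    unfolding sesq_def N_def of_real_sum
  proof (intro sum.cong refl)
    fix i
    have "(\<Sum>j\<in>I. cnj (y i) * F i j * x j) = cnj (y i) * y i"
      by (simp add: mult.assoc sum_distrib_left[symmetric] y_def[symmetric])
    then show "(\<Sum>j\<in>I. cnj (y i) * F i j * x j) = of_real ((cmod (y i))\<^sup>2)"
      by (simp only: complex_norm_square mult.commute)
  qed
  have "cnj (sesq I F y x) = (\<Sum>i\<in>I. \<Sum>j\<in>I. cnj (x j) * F j i * y i)"
    unfolding sesq_def cnj_sum
  proof (intro sum.cong refl)
    fix i j assume "i \<in> I" "j \<in> I"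
    then show "cnj (cnj (y i) * F i j * x j) = cnj (x j) * F j i * y i"
      using psd_on_hermitian[OF psd, of i j] by (simp add: mult_ac)
  qed
  also have "\<dots> = sesq I F x y" unfolding sesq_def by (rule sum.swap)
  finally have xy: "sesq I F x y = of_real N" by (simp add: yx)
  have expand: "sesq I F (\<lambda>i. x i + of_real t * y i) (\<lambda>i. x i + of_real t * y i)
      = of_real (2 * t * N) + of_real (t\<^sup>2) * sesq I F y y" for t
  proof -
    have "sesq I F (\<lambda>i. x i + of_real t * y i) (\<lambda>i. x i + of_real t * y i)
      = sesq I F x x + of_real t * sesq I F x y + of_real t * sesq I F y x + of_real (t\<^sup>2) * sesq I F y y"
    proof -
      have "sesq I F (\<lambda>i. x i + of_real t * y i) (\<lambda>i. x i + of_real t * y i)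
        = (\<Sum>i\<in>I. \<Sum>j\<in>I. cnj (x i) * F i j * x j + of_real t * (cnj (x i) * F i j * y j)
            + of_real t * (cnj (y i) * F i j * x j) + of_real (t\<^sup>2) * (cnj (y i) * F i j * y j))"
        unfolding sesq_def by (intro sum.cong refl) (simp add: algebra_simps power2_eq_square)
      then show ?thesis by (simp only: sesq_def sum.distrib sum_distrib_left)
    qed
    then show ?thesis using zero xy yx by (simp add: algebra_simps)
  qed
  define c where "c = Re (sesq I F y y)"
  have c0: "c \<ge> 0" using psd_on_nonneg[OF psd] by (simp add: c_def)
  have ineq: "0 \<le> 2 * t * N + t\<^sup>2 * c" for t
  proof -
    have "0 \<le> Re (sesq I F (\<lambda>i. x i + of_real t * y i) (\<lambda>i. x i + of_real t * y i))"
      by (rule psd_on_nonneg[OF psd])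
    then show ?thesis unfolding expand c_def by simp
  qed
  have "N > 0" unfolding N_def
    by (rule sum_pos2[OF \<open>finite I\<close> \<open>i \<in> I\<close>]) (use ne in \<open>auto simp: y_def\<close>)
  \<comment> \<open>The quadratic polynomial in \<open>t\<close> is negative at \<open>- u\<close> whenever \<open>u > 0\<close> and \<open>u c < 2 N\<close>; the
    denominator \<open>c + 1\<close> covers the case \<open>c = 0\<close> as well.\<close>
  define u where "u = N / (c + 1)"
  have "u > 0" and N: "N = u * (c + 1)" using c0 \<open>N > 0\<close> by (simp_all add: u_def)
  have "2 * (- u) * N + (- u)\<^sup>2 * c = - (u\<^sup>2 * (c + 2))"
    by (simp add: N power2_eq_square algebra_simps)
  also have "\<dots> < 0" using c0 \<open>u > 0\<close> by simp
  finally show False using ineq[of "- u"] by linarith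
qed

text \<open>In a nonnegative matrix with blocks \<open>A\<close>, \<open>B\<close> in the first row, the range of \<open>B\<close> lies in that
  of \<open>A\<close>: a null vector of \<open>A\<close>, padded with zeros, is isotropic and hence a null vector of the
  whole matrix, so that it is annihilated by the adjoint of \<open>B\<close> too.\<close>

lemma psd_on_block_range:
  assumes psd: "psd_on (I \<union> P) F" and fin: "finite I" "finite P"
  shows "\<exists>X. \<forall>i\<in>I. \<forall>p\<in>P. F i p = (\<Sum>k\<in>I. F i k * X k p)"
proof -
  have "\<exists>y. \<forall>i\<in>I. (\<Sum>k\<in>I. F i k * y k) = F i p" if p: "p \<in> P" for p
  proof (rule fredholm_alternative[OF fin(1) fin(1)])
    fix w assume w: "\<And>j. j \<in> I \<Longrightarrow> (\<Sum>i\<in>I. w i * F i j) = 0"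
    have herm: "cnj (F j i) = F i j" if "i \<in> I \<union> P" "j \<in> I \<union> P" for i j
      using psd_on_hermitian[OF psd, of j i] that by simp
    define x where "x i = (if i \<in> I then cnj (w i) else 0)" for i
    have Fx: "(\<Sum>j\<in>I \<union> P. F i j * x j) = cnj (\<Sum>j\<in>I. w j * F j i)" if "i \<in> I \<union> P" for i
    proof -
      have "(\<Sum>j\<in>I \<union> P. F i j * x j) = (\<Sum>j\<in>I. F i j * x j)"
        by (rule sum.mono_neutral_right) (use fin in \<open>auto simp: x_def\<close>)
      also have "\<dots> = (\<Sum>j\<in>I. cnj (w j * F j i))"
        by (rule sum.cong) (use that herm[of i] in \<open>auto simp: x_def mult.commute\<close>)
      finally show ?thesis by simp
    qed
    have "sesq (I \<union> P) F x x = (\<Sum>i\<in>I \<union> P. cnj (x i) * (\<Sum>j\<in>I \<union> P. F i j * x j))"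
      by (simp add: sesq_def sum_distrib_left mult.assoc)
    also have "\<dots> = 0"
    proof (rule sum.neutral, intro ballI)
      fix i assume "i \<in> I \<union> P"
      then show "cnj (x i) * (\<Sum>j\<in>I \<union> P. F i j * x j) = 0"
        using Fx[of i] w[of i] by (cases "i \<in> I") (simp_all add: x_def)
    qed
    finally have "(\<Sum>j\<in>I \<union> P. F p j * x j) = 0"
      using psd_on_kernel[OF psd] fin p by blast
    then show "(\<Sum>i\<in>I. w i * F i p) = 0" using Fx[of p] p by (simp del: cnj_sum)
  qed
  then have "\<forall>p. \<exists>y. p \<in> P \<longrightarrow> (\<forall>i\<in>I. (\<Sum>k\<in>I. F i k * y k) = F i p)" by blast
  then obtain Y where "\<And>p. p \<in> P \<Longrightarrow> \<forall>i\<in>I. (\<Sum>k\<in>I. F i k * Y p k) = F i p" by metis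
  then show ?thesis by (intro exI[of _ "\<lambda>k p. Y p k"]) auto
qed

section \<open>Block Hankel kernels\<close>

definition block_index :: "nat \<Rightarrow> nat \<Rightarrow> (nat \<times> nat) set" where
  "block_index q n = {..<n} \<times> {..<q}"

text \<open>Entry \<open>(p, r)\<close> of the infinite block Hankel matrix, rows and columns being addressed by
  pairs (number of the block, position within the block). Working with such pairs keeps
  \<open>div\<close> and \<open>mod\<close> out of all arguments about positivity; \<open>s\<close> is read only at the indices
  that the chosen index set reaches, so a finite sequence needs no special treatment.\<close>

definition hankel_kernel :: "(nat \<Rightarrow> complex mat) \<Rightarrow> nat \<times> nat \<Rightarrow> nat \<times> nat \<Rightarrow> complex" where
  "hankel_kernel s p r = s (fst p + fst r) $$ (snd p, snd r)"

abbreviation hankel_psd :: "nat \<Rightarrow> nat \<Rightarrow> (nat \<Rightarrow> complex mat) \<Rightarrow> bool" where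
  "hankel_psd q n s \<equiv> psd_on (block_index q n) (hankel_kernel s)"

text \<open>The block column with number \<open>n\<close>, cut off after \<open>r\<close> block rows, is a combination of the
  block columns \<open>0, \<dots>, n - 1\<close>, with coefficient matrix \<open>X\<close>. For \<open>r = n\<close> this is the range
  condition under which a nonnegative block Hankel matrix can be enlarged; for \<open>r = Suc n\<close> it says,
  for a nonnegative block Hankel matrix, that the last Schur complement vanishes.\<close>

definition hankel_col_dep :: "nat \<Rightarrow> nat \<Rightarrow> nat \<Rightarrow> (nat \<Rightarrow> complex mat) \<Rightarrow> bool" where
  "hankel_col_dep q n r s \<longleftrightarrow> (\<exists>X. \<forall>j<r. \<forall>a<q. \<forall>b<q.
     s (n + j) $$ (a, b) = (\<Sum>p\<in>block_index q n. hankel_kernel s (j, a) p * X p b))"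

text \<open>Hermitian symmetry of the leading \<open>q \<times> q\<close> entries only, so that it makes sense for terms
  of a sequence before their dimensions are known.\<close>

definition hermitian_entries :: "nat \<Rightarrow> complex mat \<Rightarrow> bool" where
  "hermitian_entries q A \<longleftrightarrow> (\<forall>a<q. \<forall>b<q. cnj (A $$ (b, a)) = A $$ (a, b))"

lemma finite_block_index [simp]: "finite (block_index q n)"
  by (simp add: block_index_def)

lemma in_block_index: "p \<in> block_index q n \<longleftrightarrow> fst p < n \<and> snd p < q"
  by (cases p) (auto simp: block_index_def)

lemma sum_block_index: "(\<Sum>p\<in>block_index q n. f p) = (\<Sum>i<n. \<Sum>a<q. f (i, a))"
  by (simp add: block_index_def sum.cartesian_product)

lemma hankel_psd_mono: "hankel_psd q n s \<Longrightarrow> m \<le> n \<Longrightarrow> hankel_psd q m s"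
  by (rule psd_on_subset) (auto simp: in_block_index)

lemma hankel_psd_hermitian:
  assumes "hankel_psd q n s" "j + 1 < 2 * n"
  shows "hermitian_entries q (s j)"
  unfolding hermitian_entries_def
proof (intro allI impI)
  fix a b assume "a < q" "b < q"
  \<comment> \<open>Write \<open>j\<close> as the sum of two block indices below \<open>n\<close>.\<close>
  define i where "i = min j (n - 1)"
  have "(i, b) \<in> block_index q n" "(j - i, a) \<in> block_index q n" and [simp]: "i + (j - i) = j" "j - i + i = j"
    using assms(2) \<open>a < q\<close> \<open>b < q\<close> by (auto simp: in_block_index i_def)
  from psd_on_hermitian[OF assms(1) this(1,2)] show "cnj (s j $$ (b, a)) = s j $$ (a, b)"
    by (simp add: hankel_kernel_def)
qed

lemma hankel_psd_cong:
  assumes "\<And>j. j + 1 < 2 * n \<Longrightarrow> s j = t j"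
  shows "hankel_psd q n s \<longleftrightarrow> hankel_psd q n t"
  by (rule psd_on_cong) (auto simp: in_block_index hankel_kernel_def intro!: arg_cong2[where f = index_mat] assms)

lemma hankel_col_dep_cong:
  assumes "\<And>j. j < n + r \<Longrightarrow> s j = t j"
  shows "hankel_col_dep q n r s \<longleftrightarrow> hankel_col_dep q n r t"
proof -
  have "(s (n + j) $$ (a, b) = (\<Sum>p\<in>block_index q n. hankel_kernel s (j, a) p * X p b))
    \<longleftrightarrow> (t (n + j) $$ (a, b) = (\<Sum>p\<in>block_index q n. hankel_kernel t (j, a) p * X p b))"
    if "j < r" for j a b and X :: "nat \<times> nat \<Rightarrow> nat \<Rightarrow> complex"
  proof -
    have "(\<Sum>p\<in>block_index q n. hankel_kernel s (j, a) p * X p b)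
      = (\<Sum>p\<in>block_index q n. hankel_kernel t (j, a) p * X p b)"
      by (rule sum.cong) (use that assms in \<open>auto simp: in_block_index hankel_kernel_def\<close>)
    then show ?thesis using assms[of "n + j"] that by simp
  qed
  then show ?thesis unfolding hankel_col_dep_def by (intro ex_cong1 all_cong1 imp_cong refl)
qed

lemma hankel_psd_col_dep:
  assumes "hankel_psd q (Suc n) s"
  shows "hankel_col_dep q n n s"
proof -
  have "block_index q (Suc n) = block_index q n \<union> ({n} \<times> {..<q})"
    by (auto simp: block_index_def)
  with assms have "psd_on (block_index q n \<union> ({n} \<times> {..<q})) (hankel_kernel s)" by simp
  from psd_on_block_range[OF this] obtain X where
    X: "\<And>i p. i \<in> block_index q n \<Longrightarrow> p \<in> {n} \<times> {..<q} \<Longrightarrow>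
        hankel_kernel s i p = (\<Sum>k\<in>block_index q n. hankel_kernel s i k * X k p)"
    by auto
  show ?thesis unfolding hankel_col_dep_def
  proof (intro exI[of _ "\<lambda>k b. X k (n, b)"] allI impI)
    fix j a b assume "j < n" "a < q" "b < q"
    then show "s (n + j) $$ (a, b) = (\<Sum>p\<in>block_index q n. hankel_kernel s (j, a) p * X p (n, b))"
      using X[of "(j, a)" "(n, b)"] by (simp add: in_block_index hankel_kernel_def add.commute)
  qed
qed

text \<open>If the block Hankel matrix has no null vectors, every column, in particular the next
  one, is in its range.\<close>

lemma hankel_col_dep_nondegenerate:
  assumes "hankel_psd q n s"
    and inj: "\<And>x p. (\<And>i. i \<in> block_index q n \<Longrightarrow> (\<Sum>r\<in>block_index q n. hankel_kernel s i r * x r) = 0)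
      \<Longrightarrow> p \<in> block_index q n \<Longrightarrow> x p = 0"
  shows "hankel_col_dep q n n s"
proof -
  let ?B = "block_index q n"
  have "\<exists>y. \<forall>i\<in>?B. (\<Sum>k\<in>?B. hankel_kernel s i k * y k) = s (n + fst i) $$ (snd i, b)" for b
  proof (rule fredholm_alternative)
    fix w assume w: "\<And>j. j \<in> ?B \<Longrightarrow> (\<Sum>i\<in>?B. w i * hankel_kernel s i j) = 0"
    have "(\<Sum>r\<in>?B. hankel_kernel s i r * cnj (w r)) = 0" if "i \<in> ?B" for i
    proof -
      have "(\<Sum>r\<in>?B. hankel_kernel s i r * cnj (w r)) = cnj (\<Sum>r\<in>?B. w r * hankel_kernel s r i)"
        unfolding cnj_sum
        by (rule sum.cong) (use psd_on_hermitian[OF assms(1) _ that] that in \<open>simp_all add: mult.commute\<close>)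
      then show ?thesis using w[OF that] by simp
    qed
    from inj[of "\<lambda>r. cnj (w r)", OF this] have "w p = 0" if "p \<in> ?B" for p using that by simp
    then show "(\<Sum>i\<in>?B. w i * s (n + fst i) $$ (snd i, b)) = 0" by (simp add: sum.neutral)
  qed simp_all
  then have "\<forall>b. \<exists>y. \<forall>i\<in>?B. (\<Sum>k\<in>?B. hankel_kernel s i k * y k) = s (n + fst i) $$ (snd i, b)" by blast
  then obtain Y where Y: "\<And>b i. i \<in> ?B \<Longrightarrow> (\<Sum>k\<in>?B. hankel_kernel s i k * Y b k) = s (n + fst i) $$ (snd i, b)"
    by metis
  show ?thesis unfolding hankel_col_dep_def
    by (intro exI[of _ "\<lambda>k b. Y b k"]) (use Y[of "(_, _)"] in \<open>auto simp: in_block_index\<close>)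
qed

text \<open>If the next block column is \<open>H X\<close>, then putting \<open>X\<^sup>* H X\<close> into the new corner makes the
  enlarged matrix the congruence of \<open>H\<close> by the block row \<open>(I, X)\<close>. With this choice the
  column relation also holds in the new block row; that extra conclusion is what makes the
  extension degenerate.\<close>

lemma hankel_psd_extend:
  assumes psd: "hankel_psd q n s" and herm: "\<And>j. j < 2 * n \<Longrightarrow> hermitian_entries q (s j)"
    and dep: "hankel_col_dep q n n s"
  obtains A where "A \<in> carrier_mat q q" "hankel_psd q (Suc n) (s(2 * n := A))"
    "hankel_col_dep q n (Suc n) (s(2 * n := A))"
proof -
  let ?B = "block_index q n" and ?K = "hankel_kernel s"
  from dep obtain X where X: "\<And>j a b. j < n \<Longrightarrow> a < q \<Longrightarrow> b < q \<Longrightarrow>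
      s (n + j) $$ (a, b) = (\<Sum>p\<in>?B. ?K (j, a) p * X p b)"
    unfolding hankel_col_dep_def by blast
  define A where "A = mat q q (\<lambda>(a, b). \<Sum>i\<in>?B. \<Sum>k\<in>?B. cnj (X i a) * ?K i k * X k b)"
  define t where "t = s(2 * n := A)"
  have t: "t j = s j" if "j < 2 * n" for j using that by (simp add: t_def)
  define T where "T i p = (if fst p < n then (if i = p then 1 else 0) else X i (snd p))"
    for i p :: "nat \<times> nat"
  have col: "?K p (n, b) = (\<Sum>k\<in>?B. ?K p k * X k b)" if "p \<in> ?B" "b < q" for p b
    using X[of "fst p" "snd p" b] that by (simp add: in_block_index hankel_kernel_def add.commute)
  have row: "?K (n, a) p = (\<Sum>i\<in>?B. cnj (X i a) * ?K i p)" if "p \<in> ?B" "a < q" for p a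
  proof -
    have "?K (n, a) p = cnj (?K p (n, a))"
      using herm[of "n + fst p"] that
      by (simp add: in_block_index hankel_kernel_def hermitian_entries_def add.commute)
    also have "\<dots> = (\<Sum>i\<in>?B. cnj (X i a) * ?K i p)"
      unfolding col[OF that] cnj_sum
    proof (rule sum.cong[OF refl])
      fix i assume "i \<in> ?B"
      show "cnj (?K p i * X i a) = cnj (X i a) * ?K i p"
        using psd_on_hermitian[OF psd \<open>p \<in> ?B\<close> \<open>i \<in> ?B\<close>] by simp
    qed
    finally show ?thesis .
  qed
  have pull: "hankel_kernel t p r = (\<Sum>i\<in>?B. \<Sum>k\<in>?B. cnj (T i p) * ?K i k * T k r)"
    if "p \<in> block_index q (Suc n)" "r \<in> block_index q (Suc n)" for p r
  proof -
    obtain i a j b where p: "p = (i, a)" and r: "r = (j, b)" by (cases p, cases r)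
    have le: "i \<le> n" "a < q" "j \<le> n" "b < q" using that by (auto simp: in_block_index p r)
    \<comment> \<open>Column \<open>r\<close> of the right factor is a unit vector or a column of \<open>X\<close>; the left factor is
      treated in the same way afterwards.\<close>
    have inner: "(\<Sum>k\<in>?B. cnj (T l p) * ?K l k * T k r) = cnj (T l p) * ?K l r" if "l \<in> ?B" for l
    proof (cases "j < n")
      case True
      then have "r \<in> ?B" using le by (simp add: in_block_index r)
      then show ?thesis using True
        by (simp add: T_def r if_distrib[of "\<lambda>c. _ * c"] cong: if_cong)
    next
      case False
      then have "j = n" using le by simp
      then show ?thesis using col[OF that \<open>b < q\<close>]
        by (simp add: T_def r sum_distrib_left mult.assoc)
    qed
    have outer: "(\<Sum>l\<in>?B. cnj (T l p) * ?K l r) = ?K p r" if "i < n"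
    proof -
      have "p \<in> ?B" using le that by (simp add: in_block_index p)
      then show ?thesis using that
        by (simp add: T_def p if_distrib[of cnj] if_distrib[of "\<lambda>c. c * _"] cong: if_cong)
    qed
    have "(\<Sum>l\<in>?B. \<Sum>k\<in>?B. cnj (T l p) * ?K l k * T k r) = (\<Sum>l\<in>?B. cnj (T l p) * ?K l r)"
      by (rule sum.cong) (use inner in auto)
    also have "\<dots> = hankel_kernel t p r"
    proof (cases "i < n")
      case True
      then show ?thesis using outer le by (simp add: hankel_kernel_def t p r)
    next
      case False
      then have i: "i = n" using le by simp
      show ?thesis
      proof (cases "j < n")
        case True
        then have "r \<in> ?B" using le by (simp add: in_block_index r)
        have "?K (n, a) r = (\<Sum>l\<in>?B. cnj (X l a) * ?K l r)"
          using row[OF \<open>r \<in> ?B\<close> \<open>a < q\<close>] .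
        then show ?thesis using True i
          by (simp add: T_def p r) (simp add: hankel_kernel_def t)
      next
        case False
        then have "j = n" using le by simp
        then have "hankel_kernel t p r = A $$ (a, b)"
          by (simp add: hankel_kernel_def t_def p r i mult_2)
        also have "\<dots> = (\<Sum>l\<in>?B. \<Sum>k\<in>?B. cnj (X l a) * ?K l k * X k b)"
          using le by (simp add: A_def)
        also have "\<dots> = (\<Sum>l\<in>?B. cnj (T l p) * ?K l r)"
          by (rule sum.cong) (use col \<open>j = n\<close> le in \<open>auto simp: T_def p r i sum_distrib_left mult.assoc\<close>)
        finally show ?thesis by simp
      qed
    qed
    finally show ?thesis by simp
  qed
  have "psd_on (block_index q (Suc n)) (\<lambda>p r. \<Sum>i\<in>?B. \<Sum>k\<in>?B. cnj (T i p) * ?K i k * T k r)"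
    by (rule psd_on_pullback[OF psd]) simp_all
  then have psd': "hankel_psd q (Suc n) t"
    by (rule psd_on_cong[THEN iffD1, rotated]) (simp add: pull)
  have "hankel_col_dep q n (Suc n) t"
    unfolding hankel_col_dep_def
  proof (intro exI[of _ X] allI impI)
    fix j a b assume le: "j < Suc n" "a < q" "b < q"
    have "(\<Sum>p\<in>?B. hankel_kernel t (j, a) p * X p b) = (\<Sum>p\<in>?B. ?K (j, a) p * X p b)"
      by (rule sum.cong) (use le in \<open>auto simp: hankel_kernel_def in_block_index t\<close>)
    also have "\<dots> = t (n + j) $$ (a, b)"
    proof (cases "j < n")
      case True
      then show ?thesis using X le by (simp add: t)
    next
      case False
      then have j: "j = n" using le by simp
      have "(\<Sum>p\<in>?B. ?K (n, a) p * X p b) = (\<Sum>p\<in>?B. \<Sum>i\<in>?B. cnj (X i a) * ?K i p * X p b)"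
        by (rule sum.cong) (use row le in \<open>auto simp: sum_distrib_right\<close>)
      also have "\<dots> = A $$ (a, b)" using le by (simp add: A_def) (rule sum.swap)
      finally show ?thesis by (simp add: j t_def mult_2)
    qed
    finally show "t (n + j) $$ (a, b) = (\<Sum>p\<in>?B. hankel_kernel t (j, a) p * X p b)" by simp
  qed
  with psd' show thesis using that[of A] by (simp add: t_def A_def)
qed

text \<open>The vector with \<open>v\<close> in block \<open>k\<close> and zeros elsewhere is isotropic as soon as
  \<open>s\<^bsub>2k\<^esub> v = 0\<close>, and is then annihilated by all block rows.\<close>

lemma hankel_kernel_mult_eq_0_up:
  assumes psd: "hankel_psd q (Suc n) s" and k: "k \<le> n"
    and "\<And>a. a < q \<Longrightarrow> (\<Sum>b<q. s (2 * k) $$ (a, b) * v b) = 0"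
    and "j \<le> n" "a < q"
  shows "(\<Sum>b<q. s (k + j) $$ (a, b) * v b) = 0"
proof -
  let ?B = "block_index q (Suc n)"
  define x where "x p = (if fst p = k then v (snd p) else 0)" for p :: "nat \<times> nat"
  have Kx: "(\<Sum>r\<in>?B. hankel_kernel s p r * x r) = (\<Sum>b<q. s (k + fst p) $$ (snd p, b) * v b)" for p
  proof -
    have "(\<Sum>r\<in>?B. hankel_kernel s p r * x r)
      = (\<Sum>i<Suc n. \<Sum>b<q. if i = k then s (k + fst p) $$ (snd p, b) * v b else 0)"
      unfolding sum_block_index by (intro sum.cong refl) (simp add: hankel_kernel_def x_def add.commute)
    also have "\<dots> = (\<Sum>i<Suc n. if i = k then (\<Sum>b<q. s (k + fst p) $$ (snd p, b) * v b) else 0)"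
      by (rule sum.cong) auto
    also have "\<dots> = (\<Sum>b<q. s (k + fst p) $$ (snd p, b) * v b)"
      using k by simp
    finally show ?thesis .
  qed
  have "sesq ?B (hankel_kernel s) x x = (\<Sum>p\<in>?B. cnj (x p) * (\<Sum>r\<in>?B. hankel_kernel s p r * x r))"
    by (simp add: sesq_def sum_distrib_left mult.assoc)
  also have "\<dots> = 0"
    by (rule sum.neutral) (use assms(3) in \<open>simp_all only: Kx, auto simp: x_def in_block_index mult_2\<close>)
  finally have "(\<Sum>r\<in>?B. hankel_kernel s (j, a) r * x r) = 0"
    using psd_on_kernel[OF psd] assms(4,5) by (simp add: in_block_index)
  then show ?thesis by (simp add: Kx)
qed

text \<open>A single application of the preceding lemma, to the first block, gives only the indices up
  to \<open>n\<close>. But knowing \<open>s\<^sub>j v = 0\<close> for \<open>j \<le> k + n\<close> includes \<open>s\<^bsub>2(k+1)\<^esub> v = 0\<close> when \<open>k + 1 < n\<close>, so the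
  lemma applies to block \<open>k + 1\<close> and raises the bound by one. The last term \<open>s\<^bsub>2n\<^esub>\<close> is not
  reached, and for \<open>n > 0\<close> it is indeed not constrained by \<open>s\<^sub>0\<close>.\<close>

lemma hankel_psd_kernel_dominated:
  assumes psd: "hankel_psd q (Suc n) s"
    and v: "\<And>a. a < q \<Longrightarrow> (\<Sum>b<q. s 0 $$ (a, b) * v b) = 0"
    and "j < 2 * n \<or> j = 0" "a < q"
  shows "(\<Sum>b<q. s j $$ (a, b) * v b) = 0"
proof -
  have step: "\<forall>j\<le>k + n. \<forall>a<q. (\<Sum>b<q. s j $$ (a, b) * v b) = 0" if "k < n \<or> k = 0" for k
    using that
  proof (induction k)
    case 0
    then show ?case using hankel_kernel_mult_eq_0_up[OF psd, of 0 v] v by simp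
  next
    case (Suc k)
    then have IH: "\<And>j a. j \<le> k + n \<Longrightarrow> a < q \<Longrightarrow> (\<Sum>b<q. s j $$ (a, b) * v b) = 0" by auto
    have up: "(\<Sum>b<q. s (Suc k + j) $$ (a, b) * v b) = 0" if "j \<le> n" "a < q" for j a
      by (rule hankel_kernel_mult_eq_0_up[OF psd]) (use Suc.prems IH that in auto)
    show ?case
    proof (intro allI impI)
      fix j a assume j: "j \<le> Suc k + n" "a < q"
      show "(\<Sum>b<q. s j $$ (a, b) * v b) = 0"
      proof (cases "j \<le> k + n")
        case False
        then have "j = Suc k + n" using j by simp
        then show ?thesis using up[of n a] j by simp
      qed (use IH j in auto)
    qed
  qed
  show ?thesis using step[of "n - 1"] assms(3,4) by (cases "n = 0") auto
qed

section \<open>The shifted sequence\<close>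

lemma shift_seq_entry:
  assumes "s j \<in> carrier_mat q q" "s (Suc j) \<in> carrier_mat q q" "a < q" "b < q"
  shows "shift_seq \<alpha> s j $$ (a, b) = s (Suc j) $$ (a, b) - of_real \<alpha> * s j $$ (a, b)"
  using assms by (simp add: shift_seq_def)

lemma shift_seq_kernel_sum:
  assumes "\<And>i. i \<le> j + n \<Longrightarrow> s i \<in> carrier_mat q q" "a < q"
  shows "(\<Sum>p\<in>block_index q n. hankel_kernel (shift_seq \<alpha> s) (j, a) p * x p)
    = (\<Sum>p\<in>block_index q n. hankel_kernel s (Suc j, a) p * x p)
      - of_real \<alpha> * (\<Sum>p\<in>block_index q n. hankel_kernel s (j, a) p * x p)"
proof -
  have "hankel_kernel (shift_seq \<alpha> s) (j, a) p * x p
      = hankel_kernel s (Suc j, a) p * x p - of_real \<alpha> * (hankel_kernel s (j, a) p * x p)"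
    if "p \<in> block_index q n" for p
  proof -
    have "shift_seq \<alpha> s (j + fst p) $$ (a, snd p)
        = s (Suc (j + fst p)) $$ (a, snd p) - of_real \<alpha> * s (j + fst p) $$ (a, snd p)"
      by (rule shift_seq_entry) (use that assms in \<open>auto simp: in_block_index\<close>)
    then show ?thesis by (simp add: hankel_kernel_def left_diff_distrib mult.assoc)
  qed
  then show ?thesis by (simp add: sum_subtractf sum_distrib_left)
qed

text \<open>Subtract \<open>\<alpha>\<close> times each block row of the column relation from the next block row.\<close>

lemma hankel_col_dep_shift:
  assumes car: "\<And>j. j \<le> n + r \<Longrightarrow> s j \<in> carrier_mat q q"
    and dep: "hankel_col_dep q n (Suc r) s"
  shows "hankel_col_dep q n r (shift_seq \<alpha> s)"
proof -
  let ?B = "block_index q n"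
  from dep obtain X where X: "\<And>j a b. j < Suc r \<Longrightarrow> a < q \<Longrightarrow> b < q \<Longrightarrow>
      s (n + j) $$ (a, b) = (\<Sum>p\<in>?B. hankel_kernel s (j, a) p * X p b)"
    unfolding hankel_col_dep_def by blast
  show ?thesis unfolding hankel_col_dep_def
  proof (intro exI[of _ X] allI impI)
    fix j a b assume le: "j < r" "a < q" "b < q"
    have "(\<Sum>p\<in>?B. hankel_kernel (shift_seq \<alpha> s) (j, a) p * X p b)
      = (\<Sum>p\<in>?B. hankel_kernel s (Suc j, a) p * X p b)
        - of_real \<alpha> * (\<Sum>p\<in>?B. hankel_kernel s (j, a) p * X p b)"
      by (rule shift_seq_kernel_sum) (use car le in auto)
    also have "\<dots> = s (n + Suc j) $$ (a, b) - of_real \<alpha> * s (n + j) $$ (a, b)"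
      using X[of "Suc j" a b] X[of j a b] le by simp
    also have "\<dots> = shift_seq \<alpha> s (n + j) $$ (a, b)"
      using le car by (subst shift_seq_entry[of _ _ q]) auto
    finally show "shift_seq \<alpha> s (n + j) $$ (a, b) = (\<Sum>p\<in>?B. hankel_kernel (shift_seq \<alpha> s) (j, a) p * X p b)"
      by simp
  qed
qed

text \<open>A relation between the columns of the shifted sequence, solved for the highest term, is one
  between the columns of \<open>s\<close> with one more column on the right. Its coefficients are
  those of \<open>X\<close> moved to the next block, minus \<open>\<alpha> X\<close>, plus \<open>\<alpha> I\<close> in block \<open>n\<close>; these are \<open>Y0\<close> (moved
  part) and \<open>Y1\<close> (the rest) below.\<close>

lemma hankel_col_dep_unshift:
  assumes car: "\<And>j. j \<le> n + r \<Longrightarrow> s j \<in> carrier_mat q q"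
    and dep: "hankel_col_dep q n r (shift_seq \<alpha> s)"
  shows "hankel_col_dep q (Suc n) r s"
proof -
  let ?B = "block_index q n"
  from dep obtain X where X: "\<And>j a b. j < r \<Longrightarrow> a < q \<Longrightarrow> b < q \<Longrightarrow>
      shift_seq \<alpha> s (n + j) $$ (a, b) = (\<Sum>p\<in>?B. hankel_kernel (shift_seq \<alpha> s) (j, a) p * X p b)"
    unfolding hankel_col_dep_def by blast
  define Y0 where "Y0 p b = (case fst p of 0 \<Rightarrow> 0 | Suc k \<Rightarrow> X (k, snd p) b)" for p :: "nat \<times> nat" and b
  define Y1 where "Y1 p b = (if fst p < n then - of_real \<alpha> * X p b else if snd p = b then of_real \<alpha> else 0)"
    for p :: "nat \<times> nat" and b
  show ?thesis unfolding hankel_col_dep_def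
  proof (intro exI[of _ "\<lambda>p b. Y0 p b + Y1 p b"] allI impI)
    fix j a b assume le: "j < r" "a < q" "b < q"
    have 0: "(\<Sum>p\<in>block_index q (Suc n). hankel_kernel s (j, a) p * Y0 p b)
      = (\<Sum>p\<in>?B. hankel_kernel s (Suc j, a) p * X p b)"
      unfolding sum_block_index sum.lessThan_Suc_shift
      by (simp add: Y0_def hankel_kernel_def)
    have 1: "(\<Sum>p\<in>block_index q (Suc n). hankel_kernel s (j, a) p * Y1 p b)
      = of_real \<alpha> * s (n + j) $$ (a, b) - of_real \<alpha> * (\<Sum>p\<in>?B. hankel_kernel s (j, a) p * X p b)"
    proof -
      have "(\<Sum>c<q. hankel_kernel s (j, a) (n, c) * Y1 (n, c) b) = of_real \<alpha> * s (n + j) $$ (a, b)"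
        using le by (simp add: Y1_def hankel_kernel_def add.commute if_distrib[of "\<lambda>c. _ * c"] cong: if_cong)
      moreover have "(\<Sum>i<n. \<Sum>c<q. hankel_kernel s (j, a) (i, c) * Y1 (i, c) b)
        = - of_real \<alpha> * (\<Sum>i<n. \<Sum>c<q. hankel_kernel s (j, a) (i, c) * X (i, c) b)"
        unfolding sum_distrib_left by (intro sum.cong refl) (simp add: Y1_def)
      ultimately show ?thesis
        unfolding sum_block_index sum.lessThan_Suc by simp
    qed
    have "(\<Sum>p\<in>?B. hankel_kernel (shift_seq \<alpha> s) (j, a) p * X p b)
      = (\<Sum>p\<in>?B. hankel_kernel s (Suc j, a) p * X p b)
        - of_real \<alpha> * (\<Sum>p\<in>?B. hankel_kernel s (j, a) p * X p b)"
      by (rule shift_seq_kernel_sum) (use car le in auto)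
    moreover have "shift_seq \<alpha> s (n + j) $$ (a, b) = s (Suc (n + j)) $$ (a, b) - of_real \<alpha> * s (n + j) $$ (a, b)"
      by (rule shift_seq_entry) (use car le in auto)
    ultimately have "s (Suc (n + j)) $$ (a, b) - of_real \<alpha> * s (n + j) $$ (a, b)
      = (\<Sum>p\<in>?B. hankel_kernel s (Suc j, a) p * X p b) - of_real \<alpha> * (\<Sum>p\<in>?B. hankel_kernel s (j, a) p * X p b)"
      using X[OF le] by simp
    then show "s (Suc n + j) $$ (a, b) = (\<Sum>p\<in>block_index q (Suc n). hankel_kernel s (j, a) p * (Y0 p b + Y1 p b))"
      by (simp add: distrib_left sum.distrib 0 1 diff_eq_eq)
  qed
qed

section \<open>Matrices and kernels\<close>

lemma mat_adjoint_carrier [simp]: "A \<in> carrier_mat m n \<Longrightarrow> mat_adjoint A \<in> carrier_mat n m"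
  by (auto simp: mat_adjoint_def)

lemma mat_adjoint_index:
  fixes A :: "complex mat"
  assumes "A \<in> carrier_mat m n" "i < n" "j < m"
  shows "mat_adjoint A $$ (i, j) = cnj (A $$ (j, i))"
  using assms by (simp add: mat_adjoint_def mat_of_rows_index)

lemma mat_adjoint_eq_iff:
  fixes A :: "complex mat"
  assumes "A \<in> carrier_mat n n"
  shows "mat_adjoint A = A \<longleftrightarrow> (\<forall>i<n. \<forall>j<n. cnj (A $$ (j, i)) = A $$ (i, j))"
proof
  assume "mat_adjoint A = A"
  then show "\<forall>i<n. \<forall>j<n. cnj (A $$ (j, i)) = A $$ (i, j)"
    using mat_adjoint_index[OF assms] by metis
next
  assume H: "\<forall>i<n. \<forall>j<n. cnj (A $$ (j, i)) = A $$ (i, j)"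
  show "mat_adjoint A = A"
    by (rule eq_matI) (use assms carrier_matD[OF mat_adjoint_carrier[OF assms]] mat_adjoint_index[OF assms] H in auto)
qed

lemma quadratic_form_eq_sesq:
  fixes A :: "complex mat"
  assumes "A \<in> carrier_mat n n" "v \<in> carrier_vec n"
  shows "(A *\<^sub>v v) \<bullet>c v = sesq {..<n} (\<lambda>i j. A $$ (i, j)) (($) v) (($) v)"
proof -
  have "(A *\<^sub>v v) \<bullet>c v = (\<Sum>i<n. (\<Sum>j<n. A $$ (i, j) * v $ j) * cnj (v $ i))"
    using assms by (simp add: scalar_prod_def atLeast0LessThan)
  also have "\<dots> = sesq {..<n} (\<lambda>i j. A $$ (i, j)) (($) v) (($) v)"
    unfolding sesq_def sum_distrib_right by (intro sum.cong refl) (simp add: mult_ac)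
  finally show ?thesis .
qed

lemma nonneg_hermitian_iff_psd_on:
  assumes A: "A \<in> carrier_mat n n"
  shows "nonneg_hermitian A \<longleftrightarrow> psd_on {..<n} (\<lambda>i j. A $$ (i, j))"
proof -
  have "(\<forall>v\<in>carrier_vec n. 0 \<le> Re ((A *\<^sub>v v) \<bullet>c v)) \<longleftrightarrow>
      (\<forall>x. 0 \<le> Re (sesq {..<n} (\<lambda>i j. A $$ (i, j)) x x))" (is "?L \<longleftrightarrow> ?R")
  proof
    assume L: ?L
    show ?R
    proof
      fix x
      have "sesq {..<n} (\<lambda>i j. A $$ (i, j)) x x
        = sesq {..<n} (\<lambda>i j. A $$ (i, j)) (($) (vec n x)) (($) (vec n x))"
        by (simp add: sesq_def)
      then show "0 \<le> Re (sesq {..<n} (\<lambda>i j. A $$ (i, j)) x x)"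
        using L quadratic_form_eq_sesq[OF A vec_carrier, of x] by (metis vec_carrier)
    qed
  qed (use quadratic_form_eq_sesq[OF A] in auto)
  moreover have "mat_adjoint A = A \<longleftrightarrow> (\<forall>i\<in>{..<n}. \<forall>j\<in>{..<n}. A $$ (j, i) = cnj (A $$ (i, j)))"
    unfolding mat_adjoint_eq_iff[OF A] by (metis lessThan_iff)
  ultimately show ?thesis
    using A unfolding nonneg_hermitian_def psd_on_def by (simp add: square_mat.simps)
qed

lemma pos_hermitian_imp_nonneg: "pos_hermitian A \<Longrightarrow> nonneg_hermitian A"
  unfolding pos_hermitian_def nonneg_hermitian_def
proof (elim conjE, intro conjI ballI)
  fix v :: "complex vec"
  assume pos: "\<forall>v\<in>carrier_vec (dim_row A). v \<noteq> 0\<^sub>v (dim_row A) \<longrightarrow> 0 < Re ((A *\<^sub>v v) \<bullet>c v)"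
    and v: "v \<in> carrier_vec (dim_row A)"
  show "0 \<le> Re ((A *\<^sub>v v) \<bullet>c v)"
  proof (cases "v = 0\<^sub>v (dim_row A)")
    case True
    then show ?thesis by (simp add: scalar_prod_def)
  next
    case False
    then show ?thesis using pos v by (simp add: less_imp_le)
  qed
qed

lemma pos_hermitian_mult_eq_0:
  assumes "pos_hermitian A" "A \<in> carrier_mat n n" "v \<in> carrier_vec n" "A *\<^sub>v v = 0\<^sub>v n"
  shows "v = 0\<^sub>v n"
proof (rule ccontr)
  assume "v \<noteq> 0\<^sub>v n"
  then have "0 < Re ((A *\<^sub>v v) \<bullet>c v)" using assms by (auto simp: pos_hermitian_def)
  then show False using assms(3,4) by (simp add: scalar_prod_def)
qed

definition entry_index :: "nat \<Rightarrow> nat \<Rightarrow> nat \<times> nat" where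
  "entry_index q i = (i div q, i mod q)"

lemma bij_betw_entry_index:
  assumes "q \<ge> 1"
  shows "bij_betw (entry_index q) {..<n * q} (block_index q n)"
proof (rule bij_betw_byWitness[where f' = "\<lambda>p. fst p * q + snd p"])
  show "entry_index q ` {..<n * q} \<subseteq> block_index q n"
    using assms by (auto simp: entry_index_def in_block_index less_mult_imp_div_less)
  show "(\<lambda>p. fst p * q + snd p) ` block_index q n \<subseteq> {..<n * q}"
  proof clarsimp
    fix i a assume "(i, a) \<in> block_index q n"
    then have "Suc i \<le> n" "a < q" by (auto simp: in_block_index)
    then have "i * q + a < Suc i * q" by simp
    also have "\<dots> \<le> n * q" using \<open>Suc i \<le> n\<close> by (rule mult_le_mono1)
    finally show "i * q + a < n * q" .
  qed
qed (auto simp: entry_index_def in_block_index)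

lemma block_hankel_carrier [simp]: "block_hankel q s n \<in> carrier_mat (Suc n * q) (Suc n * q)"
  by (simp add: block_hankel_def block_mat_def)

lemma block_hankel_index:
  "i < Suc n * q \<Longrightarrow> j < Suc n * q \<Longrightarrow>
    block_hankel q s n $$ (i, j) = hankel_kernel s (entry_index q i) (entry_index q j)"
  by (simp add: block_hankel_def block_mat_def hankel_kernel_def entry_index_def)

lemma nonneg_block_hankel_iff:
  assumes "q \<ge> 1"
  shows "nonneg_hermitian (block_hankel q s n) \<longleftrightarrow> hankel_psd q (Suc n) s"
proof -
  let ?N = "{..<Suc n * q}" and ?B = "block_index q (Suc n)" and ?h = "entry_index q"
  have bij: "bij_betw ?h ?N ?B" by (rule bij_betw_entry_index[OF assms])
  have "nonneg_hermitian (block_hankel q s n) \<longleftrightarrow> psd_on ?N (\<lambda>i j. hankel_kernel s (?h i) (?h j))"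
    unfolding nonneg_hermitian_iff_psd_on[OF block_hankel_carrier]
    by (rule psd_on_cong) (simp add: block_hankel_index)
  also have "\<dots> \<longleftrightarrow> hankel_psd q (Suc n) s"
  proof
    assume psd: "psd_on ?N (\<lambda>i j. hankel_kernel s (?h i) (?h j))"
    let ?g = "inv_into ?N ?h"
    have "psd_on ?B (\<lambda>p r. hankel_kernel s (?h (?g p)) (?h (?g r)))"
      by (rule psd_on_reindex[OF psd]) (use bij_betw_inv_into[OF bij] in \<open>auto simp: bij_betw_def\<close>)
    then show "hankel_psd q (Suc n) s"
      by (rule psd_on_cong[THEN iffD1, rotated]) (simp only: bij_betw_inv_into_right[OF bij])
  qed (rule psd_on_reindex, use bij in \<open>auto simp: bij_betw_def\<close>)
  finally show ?thesis .
qed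

lemma block_hankel_0:
  assumes "s 0 \<in> carrier_mat q q"
  shows "block_hankel q s 0 = s 0"
  using assms by (auto simp: block_hankel_def block_mat_def mat_eq_iff)

lemma hankel_col_dep_pos:
  assumes q: "q \<ge> 1" and pos: "pos_hermitian (block_hankel q s n)"
  shows "hankel_col_dep q (Suc n) (Suc n) s"
proof (rule hankel_col_dep_nondegenerate)
  let ?B = "block_index q (Suc n)"
  show "hankel_psd q (Suc n) s"
    using pos_hermitian_imp_nonneg[OF pos] nonneg_block_hankel_iff[OF q] by simp
  fix x p assume x: "\<And>i. i \<in> ?B \<Longrightarrow> (\<Sum>r\<in>?B. hankel_kernel s i r * x r) = 0" and p: "p \<in> ?B"
  define v where "v = vec (Suc n * q) (\<lambda>i. x (entry_index q i))"
  note bij = bij_betw_entry_index[OF q, of "Suc n"]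
  have "block_hankel q s n *\<^sub>v v = 0\<^sub>v (Suc n * q)"
  proof (rule eq_vecI)
    fix i assume "i < dim_vec (0\<^sub>v (Suc n * q) :: complex vec)"
    then have i: "i < Suc n * q" by simp
    have "(block_hankel q s n *\<^sub>v v) $ i = (\<Sum>j<Suc n * q. block_hankel q s n $$ (i, j) * v $ j)"
      using i carrier_matD[OF block_hankel_carrier[of q s n]]
      by (simp add: scalar_prod_def atLeast0LessThan v_def)
    also have "\<dots> = (\<Sum>j<Suc n * q. hankel_kernel s (entry_index q i) (entry_index q j) * x (entry_index q j))"
      by (rule sum.cong) (use i in \<open>auto simp: block_hankel_index v_def\<close>)
    also have "\<dots> = (\<Sum>r\<in>?B. hankel_kernel s (entry_index q i) r * x r)"
      by (rule sum.reindex_bij_betw[OF bij])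
    also have "\<dots> = 0" by (rule x) (use i bij in \<open>auto simp: bij_betw_def\<close>)
    finally show "(block_hankel q s n *\<^sub>v v) $ i = 0\<^sub>v (Suc n * q) $ i" using i by simp
  qed (use carrier_matD[OF block_hankel_carrier[of q s n]] in simp)
  from pos_hermitian_mult_eq_0[OF pos block_hankel_carrier _ this]
  have v: "v = 0\<^sub>v (Suc n * q)" by (simp add: v_def)
  obtain i where i: "i < Suc n * q" "p = entry_index q i"
    using p bij by (auto simp: bij_betw_def)
  then have "x p = v $ i" by (simp add: v_def)
  then show "x p = 0" using v i by simp
qed

section \<open>The Moore--Penrose inverse of a Hermitian matrix\<close>

lemma mat_adjoint_mult:
  fixes A B :: "complex mat"
  assumes "A \<in> carrier_mat m n" "B \<in> carrier_mat n k"
  shows "mat_adjoint (A * B) = mat_adjoint B * mat_adjoint A"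
proof (rule eq_matI)
  have AB: "A * B \<in> carrier_mat m k" using assms by simp
  note car = AB mat_adjoint_carrier[OF assms(1)] mat_adjoint_carrier[OF assms(2)] mat_adjoint_carrier[OF AB]
  fix i j assume "i < dim_row (mat_adjoint B * mat_adjoint A)" "j < dim_col (mat_adjoint B * mat_adjoint A)"
  then have ij: "i < k" "j < m" using car by auto
  have "mat_adjoint (A * B) $$ (i, j) = cnj (\<Sum>l<n. A $$ (j, l) * B $$ (l, i))"
    using ij assms by (simp add: mat_adjoint_index[OF AB] scalar_prod_def atLeast0LessThan)
  also have "\<dots> = (\<Sum>l<n. mat_adjoint B $$ (i, l) * mat_adjoint A $$ (l, j))"
    using ij by (auto simp: mat_adjoint_index[OF assms(1)] mat_adjoint_index[OF assms(2)] mult.commute intro!: sum.cong)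
  also have "\<dots> = (mat_adjoint B * mat_adjoint A) $$ (i, j)"
    using ij carrier_matD[OF car(2)] carrier_matD[OF car(3)]
    by (simp add: scalar_prod_def atLeast0LessThan)
  finally show "mat_adjoint (A * B) $$ (i, j) = (mat_adjoint B * mat_adjoint A) $$ (i, j)" .
qed (use assms carrier_matD[OF mat_adjoint_carrier[OF assms(1)]] carrier_matD[OF mat_adjoint_carrier[OF assms(2)]]
    carrier_matD[OF mat_adjoint_carrier, of "A * B" m k] in auto)

text \<open>A Hermitian matrix and its square have the same null space, hence the same range.\<close>

lemma hermitian_factor_through_square:
  fixes A :: "complex mat"
  assumes A: "A \<in> carrier_mat n n" and herm: "mat_adjoint A = A"
  obtains Y where "Y \<in> carrier_mat n n" "A = A * A * Y"
proof -
  have H: "cnj (A $$ (j, i)) = A $$ (i, j)" if "i < n" "j < n" for i j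
    using herm that mat_adjoint_eq_iff[OF A] by simp
  have AA: "(A * A) $$ (i, j) = (\<Sum>k<n. A $$ (i, k) * A $$ (k, j))" if "i < n" "j < n" for i j
    using A that by (simp add: scalar_prod_def atLeast0LessThan)
  have "\<exists>y. \<forall>i\<in>{..<n}. (\<Sum>j<n. (A * A) $$ (i, j) * y j) = A $$ (i, b)" if b: "b < n" for b
  proof (rule fredholm_alternative)
    fix w assume w: "\<And>j. j \<in> {..<n} \<Longrightarrow> (\<Sum>i<n. w i * (A * A) $$ (i, j)) = 0"
    define r where "r k = (\<Sum>i<n. w i * A $$ (i, k))" for k
    have rA: "(\<Sum>k<n. r k * A $$ (k, j)) = 0" if "j < n" for j
    proof -
      have "(\<Sum>k<n. r k * A $$ (k, j)) = (\<Sum>k<n. \<Sum>i<n. w i * A $$ (i, k) * A $$ (k, j))"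
        by (simp add: r_def sum_distrib_right)
      also have "\<dots> = (\<Sum>i<n. \<Sum>k<n. w i * A $$ (i, k) * A $$ (k, j))" by (rule sum.swap)
      also have "\<dots> = (\<Sum>i<n. w i * (A * A) $$ (i, j))"
        by (rule sum.cong) (use AA that in \<open>auto simp: sum_distrib_left mult.assoc\<close>)
      finally show ?thesis using w that by simp
    qed
    have "of_real (\<Sum>k<n. (cmod (r k))\<^sup>2) = (\<Sum>k<n. r k * cnj (r k))"
      unfolding of_real_sum complex_norm_square ..
    also have "\<dots> = (\<Sum>k<n. \<Sum>j<n. r k * A $$ (k, j) * cnj (w j))"
    proof (rule sum.cong[OF refl])
      fix k assume "k \<in> {..<n}"
      then have "cnj (r k) = (\<Sum>j<n. A $$ (k, j) * cnj (w j))"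
        by (auto simp: r_def H mult.commute intro!: sum.cong)
      then show "r k * cnj (r k) = (\<Sum>j<n. r k * A $$ (k, j) * cnj (w j))"
        by (simp add: sum_distrib_left mult.assoc)
    qed
    also have "\<dots> = (\<Sum>j<n. \<Sum>k<n. r k * A $$ (k, j) * cnj (w j))" by (rule sum.swap)
    also have "\<dots> = (\<Sum>j<n. (\<Sum>k<n. r k * A $$ (k, j)) * cnj (w j))" by (simp add: sum_distrib_right)
    also have "\<dots> = 0" by (simp add: rA)
    finally have "(\<Sum>k<n. (cmod (r k))\<^sup>2) = 0" by (simp only: of_real_eq_0_iff)
    then have "r b = 0" using b by (subst (asm) sum_nonneg_eq_0_iff) auto
    then show "(\<Sum>i<n. w i * A $$ (i, b)) = 0" by (simp add: r_def)
  qed simp_all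
  then have "\<forall>b. \<exists>y. b < n \<longrightarrow> (\<forall>i\<in>{..<n}. (\<Sum>j<n. (A * A) $$ (i, j) * y j) = A $$ (i, b))" by blast
  then obtain y where y: "\<And>b i. b < n \<Longrightarrow> i < n \<Longrightarrow> (\<Sum>j<n. (A * A) $$ (i, j) * y b j) = A $$ (i, b)"
    by (metis lessThan_iff)
  define Y where "Y = mat n n (\<lambda>(j, b). y b j)"
  have "A = A * A * Y"
  proof (rule eq_matI)
    fix i b assume "i < dim_row (A * A * Y)" "b < dim_col (A * A * Y)"
    then have ib: "i < n" "b < n" using A by (auto simp: Y_def)
    have "(A * A * Y) $$ (i, b) = (\<Sum>j<n. (A * A) $$ (i, j) * y b j)"
    proof -
      have "(A * A * Y) $$ (i, b) = row (A * A) i \<bullet> col Y b"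
        using ib A by (intro index_mult_mat(1)) (auto simp: Y_def)
      also have "\<dots> = (\<Sum>j<n. row (A * A) i $ j * col Y b $ j)"
        by (simp add: scalar_prod_def atLeast0LessThan Y_def)
      also have "\<dots> = (\<Sum>j<n. (A * A) $$ (i, j) * y b j)"
        by (rule sum.cong) (use ib A in \<open>auto simp: Y_def\<close>)
      finally show ?thesis .
    qed
    then show "A $$ (i, b) = (A * A * Y) $$ (i, b)" using y ib by simp
  qed (use A in \<open>auto simp: Y_def\<close>)
  then show thesis using that[of Y] by (simp add: Y_def)
qed

text \<open>The projections \<open>A X\<close> and \<open>X A\<close> depend only on \<open>A\<close>, and they determine \<open>X\<close>.\<close>

lemma penrose_unique:
  fixes A X Y :: "complex mat"
  assumes A: "A \<in> carrier_mat m n" and X: "X \<in> carrier_mat n m" and Y: "Y \<in> carrier_mat n m"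
    and X1: "A * X * A = A" and X2: "X * A * X = X" and X3: "mat_adjoint (A * X) = A * X"
    and Y1: "A * Y * A = A" and Y2: "Y * A * Y = Y" and Y4: "mat_adjoint (Y * A) = Y * A"
    and Y3: "mat_adjoint (A * Y) = A * Y" and X4: "mat_adjoint (X * A) = X * A"
  shows "X = Y"
proof -
  have AX: "A * X \<in> carrier_mat m m" and AY: "A * Y \<in> carrier_mat m m"
    and XA: "X * A \<in> carrier_mat n n" and YA: "Y * A \<in> carrier_mat n n" using A X Y by auto
  have 1: "A * X = A * Y"
  proof -
    have "A * X = mat_adjoint (A * Y * A * X)" using Y1 X3 by simp
    also have "\<dots> = mat_adjoint (A * Y * (A * X))" using assoc_mult_mat[OF AY A X] by simp
    also have "\<dots> = A * X * (A * Y)" using mat_adjoint_mult[OF AY AX] X3 Y3 by simp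
    also have "\<dots> = A * X * A * Y" using assoc_mult_mat[OF AX A Y] by simp
    finally show ?thesis using X1 by simp
  qed
  have 2: "X * A = Y * A"
  proof -
    have "X * A = mat_adjoint (X * (A * Y * A))" using Y1 X4 by simp
    also have "\<dots> = mat_adjoint (X * A * (Y * A))"
      using assoc_mult_mat[OF A Y A] assoc_mult_mat[OF X A YA] by simp
    also have "\<dots> = Y * A * (X * A)" using mat_adjoint_mult[OF XA YA] X4 Y4 by simp
    also have "\<dots> = Y * (A * X * A)" using assoc_mult_mat[OF Y A XA] assoc_mult_mat[OF A X A] by simp
    finally show ?thesis using X1 by simp
  qed
  have "X = X * A * X" using X2 by simp
  also have "\<dots> = Y * A * X" using 2 by simp
  also have "\<dots> = Y * (A * X)" using assoc_mult_mat[OF Y A X] by simp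
  also have "\<dots> = Y * A * Y" using 1 assoc_mult_mat[OF Y A Y] by simp
  finally show ?thesis using Y2 by simp
qed

text \<open>From \<open>A = A\<^sup>2 Y\<close> the matrix \<open>Y\<^sup>* A Y\<close> is seen to satisfy the four Penrose equations, since
  \<open>Y\<^sup>* A = A Y\<close> is the orthogonal projection onto the range of \<open>A\<close>. Together with uniqueness this
  makes the definite description meaningful.\<close>

lemma pseudo_inverse_hermitian:
  assumes A: "A \<in> carrier_mat n n" and herm: "mat_adjoint A = A"
  shows "pseudo_inverse A \<in> carrier_mat n n" "A * pseudo_inverse A * A = A"
proof -
  obtain Y where Y: "Y \<in> carrier_mat n n" and AAY: "A = A * A * Y"
    using hermitian_factor_through_square[OF A herm] .
  define Z where "Z = mat_adjoint Y"
  have Z: "Z \<in> carrier_mat n n" using Y by (simp add: Z_def)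
  note assoc = assoc_mult_mat[of _ n n _ n _ n]
  have ZAA: "A = Z * (A * A)"
    using arg_cong[OF AAY, of mat_adjoint] mat_adjoint_mult[of "A * A" n n Y n] mat_adjoint_mult[OF A A] A Y herm
    by (simp add: Z_def)
  have ZA: "Z * A = A * Y"
  proof -
    have "Z * A = Z * (A * A * Y)" using AAY by simp
    also have "\<dots> = Z * (A * A) * Y" using A Y Z by (simp add: assoc)
    also have "\<dots> = A * Y" using ZAA by simp
    finally show ?thesis .
  qed
  have AY_herm: "mat_adjoint (A * Y) = A * Y"
    using mat_adjoint_mult[OF A Y] herm ZA by (simp add: Z_def)
  have AZA: "A * (Z * A) = A" using AAY ZA A Y by (simp add: assoc)
  define X where "X = Z * A * Y"
  have X: "X \<in> carrier_mat n n" using A Y Z by (simp add: X_def)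
  have AX: "A * X = A * Y"
  proof -
    have "A * X = A * (Z * A) * Y" using A Y Z by (simp add: X_def assoc)
    then show ?thesis using AZA by simp
  qed
  have XA: "X * A = A * Y"
  proof -
    have "X * A = Z * (A * Y) * A" using A Y Z by (simp add: X_def assoc)
    also have "\<dots> = Z * (Z * (A * A))" using A Y Z by (simp add: ZA[symmetric] assoc)
    finally show ?thesis using ZAA ZA by simp
  qed
  have AYA: "A * Y * A = A"
    using ZAA A Z by (simp add: ZA[symmetric] assoc)
  have XAX: "X * A * X = X"
  proof -
    have "X * A * X = X * (A * X)" using A X by (simp add: assoc)
    also have "\<dots> = Z * A * Y * (A * Y)" unfolding AX by (simp add: X_def)
    also have "\<dots> = Z * (A * Y * A) * Y" using A Y Z by (simp add: assoc)
    finally show ?thesis using AYA by (simp add: X_def)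
  qed
  let ?P = "\<lambda>X. X \<in> carrier_mat (dim_col A) (dim_row A) \<and>
        A * X * A = A \<and> X * A * X = X \<and>
        mat_adjoint (A * X) = A * X \<and> mat_adjoint (X * A) = X * A"
  have PX: "?P X" using X A AX XA AYA XAX AY_herm by simp
  have "\<exists>!X. ?P X"
  proof (rule ex1I[of ?P, OF PX])
    fix X' assume X': "?P X'"
    have X'c: "X' \<in> carrier_mat n n" using X' A by simp
    show "X' = X" by (rule penrose_unique[OF A X'c X]) (use X' PX in blast)+
  qed
  from theI'[OF this] have "?P (pseudo_inverse A)" unfolding pseudo_inverse_def .
  then show "pseudo_inverse A \<in> carrier_mat n n" "A * pseudo_inverse A * A = A" using A by simp_all
qed

text \<open>The border column is \<open>y = G M\<close> by nonnegativity, so the subtracted term in the Schur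
  complement is \<open>y\<^sup>* G\<^sup>\<dagger> y = M\<^sup>* G G\<^sup>\<dagger> G M = y\<^sup>* M\<close>. Its vanishing is the column relation in the last block
  row.\<close>

lemma hankel_col_dep_schur_0:
  assumes q: "q \<ge> 1" and psd: "hankel_psd q (Suc n) s" and "s (2 * n) \<in> carrier_mat q q"
    and schur: "hankel_schur q s n = 0\<^sub>m q q"
  shows "hankel_col_dep q n (Suc n) s"
proof (cases n)
  case 0
  then show ?thesis using schur by (simp add: hankel_col_dep_def hankel_schur_def block_index_def)
next
  case n: (Suc m)
  let ?B = "block_index q n"
  obtain X where X: "\<And>j a b. j < n \<Longrightarrow> a < q \<Longrightarrow> b < q \<Longrightarrow>
      s (n + j) $$ (a, b) = (\<Sum>p\<in>?B. hankel_kernel s (j, a) p * X p b)"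
    using hankel_psd_col_dep[OF psd] unfolding hankel_col_dep_def by blast
  define N where "N = n * q"
  define G where "G = block_hankel q s m"
  define M where "M = mat N q (\<lambda>(i, b). X (entry_index q i) b)"
  define y where "y = block_mat q n 1 (\<lambda>j _. s (n + j))"
  define z where "z = block_mat q 1 n (\<lambda>_ k. s (n + k))"
  have N': "N = Suc m * q" by (simp add: N_def n)
  note bij = bij_betw_entry_index[OF q, of n, folded N_def]
  have G: "G \<in> carrier_mat N N" unfolding G_def N' by (rule block_hankel_carrier)
  have M: "M \<in> carrier_mat N q" and y: "y \<in> carrier_mat N q" and z: "z \<in> carrier_mat q N"
    by (simp_all add: M_def y_def z_def N_def block_mat_def)
  have h: "i div q < n" "i mod q < q" if "i < N" for i
    using that q by (simp_all add: N_def less_mult_imp_div_less)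
  have "nonneg_hermitian G"
    unfolding G_def nonneg_block_hankel_iff[OF q] using hankel_psd_mono[OF psd, of n] n by simp
  then have Gh: "mat_adjoint G = G" by (simp add: nonneg_hermitian_def)
  have sumM: "(\<Sum>i<N. f (entry_index q i) * M $$ (i, b)) = (\<Sum>p\<in>?B. f p * X p b)" if "b < q" for f b
    using sum.reindex_bij_betw[OF bij, of "\<lambda>p. f p * X p b"] that by (simp add: M_def)
  have yGM: "y = G * M"
  proof (rule eq_matI)
    fix i b assume "i < dim_row (G * M)" "b < dim_col (G * M)"
    then have ib: "i < N" "b < q" using G M by auto
    have "(G * M) $$ (i, b) = (\<Sum>j<N. G $$ (i, j) * M $$ (j, b))"
      using ib G M by (simp add: scalar_prod_def atLeast0LessThan)
    also have "\<dots> = (\<Sum>j<N. hankel_kernel s (entry_index q i) (entry_index q j) * M $$ (j, b))"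
      unfolding G_def by (intro sum.cong refl, subst block_hankel_index) (use ib N' in auto)
    also have "\<dots> = s (n + i div q) $$ (i mod q, b)"
      using X[of "i div q" "i mod q" b] h[OF ib(1)] ib
      by (simp add: sumM[OF ib(2), of "hankel_kernel s (entry_index q i)"]) (simp add: entry_index_def)
    also have "\<dots> = y $$ (i, b)" using ib by (simp add: y_def block_mat_def N_def)
    finally show "y $$ (i, b) = (G * M) $$ (i, b)" by simp
  qed (use G M y in auto)
  have "z = mat_adjoint y"
  proof (rule eq_matI)
    fix a i assume "a < dim_row (mat_adjoint y)" "i < dim_col (mat_adjoint y)"
    then have ai: "a < q" "i < N" using carrier_matD[OF mat_adjoint_carrier[OF y]] by auto
    have "hermitian_entries q (s (n + i div q))"
      by (rule hankel_psd_hermitian[OF psd]) (use h[OF ai(2)] in simp)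
    then show "z $$ (a, i) = mat_adjoint y $$ (a, i)"
      using ai h[OF ai(2)] unfolding mat_adjoint_index[OF y ai]
      by (simp add: z_def y_def block_mat_def N_def hermitian_entries_def)
  qed (use z carrier_matD[OF mat_adjoint_carrier[OF y]] in auto)
  then have zGM: "z = mat_adjoint M * G" using yGM mat_adjoint_mult[OF G M] Gh by simp
  let ?P = "pseudo_inverse G"
  note P = pseudo_inverse_hermitian[OF G Gh]
  have "z * ?P * y = mat_adjoint M * (G * ?P * G) * M"
    unfolding zGM yGM using G M P(1) mat_adjoint_carrier[OF M]
    by (simp add: assoc_mult_mat[of _ q N _ N _ q] assoc_mult_mat[of _ q N _ N _ N] assoc_mult_mat[of _ N N _ N _ q]
        assoc_mult_mat[of _ N N _ N _ N])
  then have zPy: "z * ?P * y = z * M" using P(2) zGM by simp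
  have "s (2 * n) - z * ?P * y = 0\<^sub>m q q"
    using schur by (simp add: hankel_schur_def G_def z_def y_def n)
  then have eq: "s (2 * n) - z * M = 0\<^sub>m q q" by (simp add: zPy)
  have last: "s (2 * n) $$ (a, b) = (\<Sum>p\<in>?B. hankel_kernel s (n, a) p * X p b)" if ab: "a < q" "b < q" for a b
  proof -
    have "(s (2 * n) - z * M) $$ (a, b) = 0" using eq ab by simp
    then have "s (2 * n) $$ (a, b) = (z * M) $$ (a, b)"
      using ab z M by simp
    also have "\<dots> = (\<Sum>i<N. hankel_kernel s (n, a) (entry_index q i) * M $$ (i, b))"
      using ab z M h
      by (simp add: scalar_prod_def atLeast0LessThan)
        (auto simp: z_def block_mat_def N_def hankel_kernel_def entry_index_def intro!: sum.cong)
    finally show ?thesis using ab by (simp add: sumM)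
  qed
  show ?thesis unfolding hankel_col_dep_def
  proof (intro exI[of _ X] allI impI)
    fix j a b assume "j < Suc n" "a < q" "b < q"
    then show "s (n + j) $$ (a, b) = (\<Sum>p\<in>?B. hankel_kernel s (j, a) p * X p b)"
      using X[of j a b] last[of a b] by (cases "j = n") (auto simp: mult_2)
  qed
qed

section \<open>Extending Stieltjes sequences\<close>

lemma hermitian_entries_shift_seq:
  assumes "s j \<in> carrier_mat q q" "s (Suc j) \<in> carrier_mat q q"
    and "hermitian_entries q (s j)"
  shows "hermitian_entries q (shift_seq \<alpha> s j) \<longleftrightarrow> hermitian_entries q (s (Suc j))"
  using assms(3) by (auto simp: hermitian_entries_def shift_seq_entry[of s j q, OF assms(1,2)])

lemma shift_seq_upd: "Suc j < m \<Longrightarrow> shift_seq \<alpha> (s(m := A)) j = shift_seq \<alpha> s j"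
  by (simp add: shift_seq_def)

text \<open>The new term of the shifted sequence is chosen by the degenerate extension, and the new
  term of \<open>s\<close> is read off from it; the Hankel matrix of \<open>s\<close> itself does not see the new term.\<close>

lemma stieltjes_extend_even:
  assumes car: "\<And>j. j \<le> 2 * n \<Longrightarrow> s j \<in> carrier_mat q q"
    and psd: "hankel_psd q (Suc n) s" "hankel_psd q n (shift_seq \<alpha> s)"
    and dep: "hankel_col_dep q n n (shift_seq \<alpha> s)"
  obtains A where "A \<in> carrier_mat q q" "hankel_psd q (Suc n) (s(2 * n + 1 := A))"
    "hankel_psd q (Suc n) (shift_seq \<alpha> (s(2 * n + 1 := A)))"
    "hankel_col_dep q n (Suc n) (shift_seq \<alpha> (s(2 * n + 1 := A)))"
proof -
  have "hermitian_entries q (shift_seq \<alpha> s j)" if "j < 2 * n" for j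
    using that car hankel_psd_hermitian[OF psd(1)] by (subst hermitian_entries_shift_seq) auto
  from hankel_psd_extend[OF psd(2) this dep]
  obtain B where B: "B \<in> carrier_mat q q"
    and B_psd: "hankel_psd q (Suc n) ((shift_seq \<alpha> s)(2 * n := B))"
    and B_dep: "hankel_col_dep q n (Suc n) ((shift_seq \<alpha> s)(2 * n := B))" .
  define A where "A = B + of_real \<alpha> \<cdot>\<^sub>m s (2 * n)"
  have A: "A \<in> carrier_mat q q" using B car by (simp add: A_def)
  have "shift_seq \<alpha> (s(2 * n + 1 := A)) (2 * n) = B"
    using B car[of "2 * n"] by (intro eq_matI) (auto simp: shift_seq_def A_def)
  then have shift: "((shift_seq \<alpha> s)(2 * n := B)) j = shift_seq \<alpha> (s(2 * n + 1 := A)) j"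
    if "j \<le> 2 * n" for j
    using that by (cases "j = 2 * n") (simp_all add: shift_seq_upd)
  show thesis
  proof (rule that[OF A])
    show "hankel_psd q (Suc n) (s(2 * n + 1 := A))"
      using psd(1) by (subst hankel_psd_cong[of _ _ s]) auto
    show "hankel_psd q (Suc n) (shift_seq \<alpha> (s(2 * n + 1 := A)))"
      by (rule hankel_psd_cong[THEN iffD1, OF _ B_psd]) (rule shift, simp)
    show "hankel_col_dep q n (Suc n) (shift_seq \<alpha> (s(2 * n + 1 := A)))"
      by (rule hankel_col_dep_cong[THEN iffD1, OF _ B_dep]) (rule shift, simp)
  qed
qed

text \<open>The term \<open>s\<^bsub>2n+1\<^esub>\<close> does not occur in the Hankel matrix of \<open>s\<close>; it is Hermitian because the shifted
  sequence has a nonnegative Hankel matrix.\<close>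

lemma stieltjes_extend_odd:
  assumes car: "\<And>j. j \<le> 2 * n + 1 \<Longrightarrow> s j \<in> carrier_mat q q"
    and psd: "hankel_psd q (Suc n) s" "hankel_psd q (Suc n) (shift_seq \<alpha> s)"
    and dep: "hankel_col_dep q (Suc n) (Suc n) s"
  obtains A where "A \<in> carrier_mat q q" "hankel_psd q (Suc (Suc n)) (s(2 * n + 2 := A))"
proof -
  have "hermitian_entries q (s j)" if "j < 2 * Suc n" for j
  proof (cases "j = 2 * n + 1")
    case True
    have "hermitian_entries q (shift_seq \<alpha> s (2 * n))" "hermitian_entries q (s (2 * n))"
      using hankel_psd_hermitian[OF psd(2)] hankel_psd_hermitian[OF psd(1)] by simp_all
    then show ?thesis using True car hermitian_entries_shift_seq[of s "2 * n" q \<alpha>] by simp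
  qed (use that hankel_psd_hermitian[OF psd(1)] in auto)
  from hankel_psd_extend[OF psd(1) this dep] show thesis using that by auto
qed

text \<open>The given next term \<open>C\<close> need not admit a further nonnegative Hankel extension: for \<open>n = 0\<close> take
  \<open>s\<^sub>0 = 0\<close> and \<open>C > 0\<close>. What \<open>C\<close> provides is the range condition for the shifted sequence. This
  allows \<open>C\<close> to be replaced by the degenerate choice \<open>A\<close>, for which the column relation carries over
  from the shifted sequence to \<open>s\<close>, so that the next Hankel extension exists.\<close>

lemma hankel_extend_of_stieltjes:
  assumes car: "\<And>j. j \<le> 2 * n \<Longrightarrow> s j \<in> carrier_mat q q" and C: "C \<in> carrier_mat q q"
    and psd: "hankel_psd q (Suc n) s" "hankel_psd q (Suc n) (shift_seq \<alpha> (s(2 * n + 1 := C)))"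
  obtains A B where "A \<in> carrier_mat q q" "B \<in> carrier_mat q q"
    "hankel_psd q (Suc (Suc n)) (s(2 * n + 1 := A, 2 * n + 2 := B))"
proof -
  have eq: "shift_seq \<alpha> (s(2 * n + 1 := C)) j = shift_seq \<alpha> s j" if "j < 2 * n" for j
    using that by (simp add: shift_seq_upd)
  have 1: "hankel_psd q n (shift_seq \<alpha> s)"
    by (rule hankel_psd_cong[THEN iffD1, OF _ hankel_psd_mono[OF psd(2)]]) (use eq in auto)
  have 2: "hankel_col_dep q n n (shift_seq \<alpha> s)"
    by (rule hankel_col_dep_cong[THEN iffD1, OF _ hankel_psd_col_dep[OF psd(2)]]) (use eq in auto)
  obtain A where A: "A \<in> carrier_mat q q" "hankel_psd q (Suc n) (s(2 * n + 1 := A))"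
      "hankel_psd q (Suc n) (shift_seq \<alpha> (s(2 * n + 1 := A)))"
      "hankel_col_dep q n (Suc n) (shift_seq \<alpha> (s(2 * n + 1 := A)))"
    using stieltjes_extend_even[OF car psd(1) 1 2] by blast
  have car': "(s(2 * n + 1 := A)) j \<in> carrier_mat q q" if "j \<le> 2 * n + 1" for j
    using that car A(1) by auto
  have "hankel_col_dep q (Suc n) (Suc n) (s(2 * n + 1 := A))"
    by (rule hankel_col_dep_unshift[OF _ A(4)]) (use car' in auto)
  from stieltjes_extend_odd[OF car' A(2,3) this] that[OF A(1)] show thesis by blast
qed

section \<open>First term domination\<close>

text \<open>For Hermitian matrices the range is the orthogonal complement of the null space, so the
  two inclusions are equivalent.\<close>

lemma dominated_of_entries:
  assumes A: "A \<in> carrier_mat q q" "hermitian_entries q A"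
    and B: "B \<in> carrier_mat q q" "hermitian_entries q B"
    and dom: "\<And>v a. (\<And>a. a < q \<Longrightarrow> (\<Sum>b<q. A $$ (a, b) * v b) = 0) \<Longrightarrow> a < q \<Longrightarrow>
      (\<Sum>b<q. B $$ (a, b) * v b) = 0"
  shows "mat_kernel A \<subseteq> mat_kernel B \<and> vec_space.col_space q B \<subseteq> vec_space.col_space q A"
proof
  have mult: "(M *\<^sub>v v) $ a = (\<Sum>b<q. M $$ (a, b) * v $ b)"
    if "M \<in> carrier_mat q q" "v \<in> carrier_vec q" "a < q" for M :: "complex mat" and v a
    using that by (simp add: scalar_prod_def atLeast0LessThan)
  show "mat_kernel A \<subseteq> mat_kernel B"
  proof
    fix v assume "v \<in> mat_kernel A"
    then have v: "v \<in> carrier_vec q" and Av: "A *\<^sub>v v = 0\<^sub>v q" using mat_kernelD[OF A(1)] by auto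
    have "B *\<^sub>v v = 0\<^sub>v q"
    proof (rule eq_vecI)
      fix a assume "a < dim_vec (0\<^sub>v q :: complex vec)"
      then have a: "a < q" by simp
      have "(\<Sum>b<q. A $$ (c, b) * v $ b) = 0" if "c < q" for c
        using mult[OF A(1) v that] Av that by simp
      from dom[of "\<lambda>b. v $ b", OF this a] show "(B *\<^sub>v v) $ a = 0\<^sub>v q $ a"
        using mult[OF B(1) v a] a by simp
    qed (use B in simp)
    then show "v \<in> mat_kernel B" using mat_kernelI[OF B(1) v] by simp
  qed
  show "vec_space.col_space q B \<subseteq> vec_space.col_space q A"
  proof
    fix y assume "y \<in> vec_space.col_space q B"
    then obtain x where x: "x \<in> carrier_vec q" and y: "y = B *\<^sub>v x"
      using B(1) unfolding vec_space.col_space_eq[OF B(1)] by auto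
    have "\<exists>u. \<forall>a\<in>{..<q}. (\<Sum>b<q. A $$ (a, b) * u b) = y $ a"
    proof (rule fredholm_alternative)
      fix w assume w: "\<And>b. b \<in> {..<q} \<Longrightarrow> (\<Sum>a<q. w a * A $$ (a, b)) = 0"
      have adj: "(\<Sum>b<q. M $$ (a, b) * cnj (w b)) = cnj (\<Sum>b<q. w b * M $$ (b, a))"
        if "hermitian_entries q M" "a < q" for M a
        using that by (auto simp: hermitian_entries_def mult.commute intro!: sum.cong)
      have "(\<Sum>b<q. A $$ (a, b) * cnj (w b)) = 0" if "a < q" for a
        using adj[OF A(2) that] w that by (simp del: cnj_sum)
      then have "(\<Sum>b<q. B $$ (a, b) * cnj (w b)) = 0" if "a < q" for a
        using dom[of "\<lambda>b. cnj (w b)"] that by blast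
      then have wB: "(\<Sum>a<q. w a * B $$ (a, b)) = 0" if "b < q" for b
        using adj[OF B(2) that] that by (metis complex_cnj_zero_iff)
      have "(\<Sum>a<q. w a * y $ a) = (\<Sum>a<q. \<Sum>b<q. w a * B $$ (a, b) * x $ b)"
        by (rule sum.cong) (use mult[OF B(1) x] in \<open>auto simp: y sum_distrib_left mult.assoc\<close>)
      also have "\<dots> = (\<Sum>b<q. \<Sum>a<q. w a * B $$ (a, b) * x $ b)" by (rule sum.swap)
      also have "\<dots> = (\<Sum>b<q. (\<Sum>a<q. w a * B $$ (a, b)) * x $ b)" by (simp add: sum_distrib_right)
      also have "\<dots> = 0" by (simp add: wB)
      finally show "(\<Sum>a<q. w a * y $ a) = 0" .
    qed simp_all
    then obtain u where u: "\<And>a. a < q \<Longrightarrow> (\<Sum>b<q. A $$ (a, b) * u b) = y $ a" by auto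
    have "A *\<^sub>v vec q u = y"
      by (rule eq_vecI) (use A(1) B(1) y u mult[OF A(1), of "vec q u"] in auto)
    then show "y \<in> vec_space.col_space q A"
      using A(1) B(1) y x unfolding vec_space.col_space_eq[OF A(1)] by auto
  qed
qed

lemma hankel_psd_dominated:
  assumes psd: "hankel_psd q (Suc n) s" and j: "j < 2 * n \<or> j = 0"
    and car: "s 0 \<in> carrier_mat q q" "s j \<in> carrier_mat q q"
  shows "mat_kernel (s 0) \<subseteq> mat_kernel (s j) \<and>
    vec_space.col_space q (s j) \<subseteq> vec_space.col_space q (s 0)"
proof (rule dominated_of_entries)
  show "hermitian_entries q (s 0)" "hermitian_entries q (s j)"
    using hankel_psd_hermitian[OF psd] j by auto
qed (use car hankel_psd_kernel_dominated[OF psd _ j] in auto)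

text \<open>The Hankel matrix of \<open>s\<close> controls the indices below \<open>2n\<close>. For index \<open>2n\<close> the Hankel matrix
  of the shifted sequence is used: it dominates \<open>s\<^bsub>2n\<^esub> - \<alpha> s\<^bsub>2n-1\<^esub>\<close> by \<open>s\<^sub>1 - \<alpha> s\<^sub>0\<close>, and the other
  terms are already under control.\<close>

lemma stieltjes_psd_dominated:
  assumes car: "\<And>j. j \<le> 2 * n + 1 \<Longrightarrow> s j \<in> carrier_mat q q"
    and psd: "hankel_psd q (Suc n) s" "hankel_psd q (Suc n) (shift_seq \<alpha> s)"
    and j: "j \<le> 2 * n"
  shows "mat_kernel (s 0) \<subseteq> mat_kernel (s j) \<and>
    vec_space.col_space q (s j) \<subseteq> vec_space.col_space q (s 0)"
proof (cases "j < 2 * n \<or> j = 0")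
  case True
  then show ?thesis using hankel_psd_dominated[OF psd(1) True] car j by simp
next
  case False
  then have n: "n \<ge> 1" and jn: "j = 2 * n" using j by auto
  have shift: "(\<Sum>b<q. shift_seq \<alpha> s i $$ (a, b) * v b)
    = (\<Sum>b<q. s (Suc i) $$ (a, b) * v b) - of_real \<alpha> * (\<Sum>b<q. s i $$ (a, b) * v b)"
    if "i \<le> 2 * n" "a < q" for i a v
  proof -
    have "(\<Sum>b<q. shift_seq \<alpha> s i $$ (a, b) * v b)
      = (\<Sum>b<q. s (Suc i) $$ (a, b) * v b - of_real \<alpha> * (s i $$ (a, b) * v b))"
      by (rule sum.cong) (use that car in \<open>auto simp: shift_seq_entry[of _ _ q] left_diff_distrib\<close>)
    then show ?thesis by (simp add: sum_subtractf sum_distrib_left)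
  qed
  show ?thesis
  proof (rule dominated_of_entries)
    show "hermitian_entries q (s 0)" "hermitian_entries q (s j)"
      using hankel_psd_hermitian[OF psd(1)] j by auto
    fix v a assume v: "\<And>a. a < q \<Longrightarrow> (\<Sum>b<q. s 0 $$ (a, b) * v b) = 0" and a: "a < q"
    note dom = hankel_psd_kernel_dominated[OF psd(1) v]
    have "(\<Sum>b<q. shift_seq \<alpha> s 0 $$ (c, b) * v b) = 0" if "c < q" for c
      using shift[of 0 c v] dom[of 1 c] v that n by simp
    from hankel_psd_kernel_dominated[OF psd(2) this, of "2 * n - 1" a]
    have "(\<Sum>b<q. shift_seq \<alpha> s (2 * n - 1) $$ (a, b) * v b) = 0" using a n by simp
    then show "(\<Sum>b<q. s j $$ (a, b) * v b) = 0"
      using shift[of "2 * n - 1" a v] dom[of "2 * n - 1" a] a n jn by simp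
  qed (use car j in auto)
qed

section \<open>The classes of sequences\<close>

lemma mat_seqs_carrier: "s \<in> mat_seqs q \<kappa> \<Longrightarrow> enat j \<le> \<kappa> \<Longrightarrow> s j \<in> carrier_mat q q"
  by (auto simp: mat_seqs_def)

lemma mat_seqs_upd:
  "s \<in> mat_seqs q (enat m) \<Longrightarrow> A \<in> carrier_mat q q \<Longrightarrow> s(m + 1 := A) \<in> mat_seqs q (enat (m + 1))"
  by (auto simp: mat_seqs_def PiE_def Pi_def extensional_def)

lemma mat_seqs_restrict: "s \<in> mat_seqs q \<kappa> \<Longrightarrow> enat m \<le> \<kappa> \<Longrightarrow> restrict s {..m} \<in> mat_seqs q (enat m)"
proof -
  assume "s \<in> mat_seqs q \<kappa>" "enat m \<le> \<kappa>"
  then have "s j \<in> carrier_mat q q" if "j \<le> m" for j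
    using mat_seqs_carrier that order_trans enat_ord_simps(1) by metis
  then show ?thesis by (auto simp: mat_seqs_def)
qed

lemma hankel_psd_restrict:
  "2 * n \<le> m + 2 \<Longrightarrow> hankel_psd q n (restrict s {..m}) \<longleftrightarrow> hankel_psd q n s"
  by (rule hankel_psd_cong) auto

lemma hankel_fin_iff:
  assumes "q \<ge> 1"
  shows "s \<in> hankel_fin q m \<longleftrightarrow> s \<in> mat_seqs q (enat m) \<and> even m \<and> hankel_psd q (Suc (m div 2)) s"
  by (simp add: hankel_fin_def nonneg_block_hankel_iff[OF assms])

text \<open>The separate clause for \<open>m = 0\<close> is absorbed because \<open>s\<^sub>0\<close> is the block Hankel matrix with one
  block.\<close>

lemma stieltjes_fin_iff:
  assumes "s \<in> mat_seqs q (enat m)"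
  shows "s \<in> stieltjes_fin P q \<alpha> m \<longleftrightarrow> P (block_hankel q s (m div 2)) \<and>
    (m \<ge> 1 \<longrightarrow> P (block_hankel q (shift_seq \<alpha> s) ((m - 1) div 2)))"
proof (cases "m = 0")
  case True
  then show ?thesis
    using assms block_hankel_0[of s q] mat_seqs_carrier[OF assms, of 0] by (simp add: stieltjes_fin_def)
next
  case False
  then have "even m \<Longrightarrow> m div 2 - 1 = (m - 1) div 2" "odd m \<Longrightarrow> m div 2 = (m - 1) div 2"
    by (auto elim!: evenE oddE)
  then show ?thesis using False assms by (simp add: stieltjes_fin_def)
qed

lemma psd_on_empty [simp]: "psd_on {} F"
  by (simp add: psd_on_def sesq_def)

lemma block_index_0 [simp]: "block_index q 0 = {}"
  by (simp add: block_index_def)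

text \<open>Counting blocks instead of last indices unifies both parities; for \<open>m = 0\<close> the second condition
  concerns an empty matrix.\<close>

lemma stieltjes_nonneg_iff:
  assumes "q \<ge> 1"
  shows "s \<in> stieltjes_nonneg q \<alpha> (enat m) \<longleftrightarrow> s \<in> mat_seqs q (enat m) \<and>
    hankel_psd q (Suc (m div 2)) s \<and> hankel_psd q (Suc m div 2) (shift_seq \<alpha> s)"
proof (cases "s \<in> mat_seqs q (enat m)")
  case True
  have "Suc m div 2 = (if m = 0 then 0 else Suc ((m - 1) div 2))" by (cases m) auto
  then show ?thesis
    using True by (simp add: stieltjes_def stieltjes_fin_iff[OF True] nonneg_block_hankel_iff[OF assms])
qed (simp add: stieltjes_def stieltjes_fin_def)

lemma stieltjes_infinity_restrict:
  "s \<in> stieltjes P q \<alpha> \<infinity> \<Longrightarrow> restrict s {..m} \<in> stieltjes P q \<alpha> (enat m)"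
  by (simp add: stieltjes_def)

lemma twice_infinity: "2 * (\<infinity>::enat) = \<infinity>"
  by (simp add: imult_infinity_right)

lemma stieltjes_nonneg_subset_hankel:
  assumes q: "q \<ge> 1"
  shows "stieltjes_nonneg q \<alpha> (2 * \<kappa>) \<subseteq> hankel q (2 * \<kappa>)"
proof (cases \<kappa>)
  case (enat k)
  have "2 * enat k = enat (2 * k)" by (simp add: numeral_eq_enat)
  then show ?thesis using enat stieltjes_nonneg_iff[OF q] hankel_fin_iff[OF q]
    by (auto simp: hankel_def)
next
  case infinity
  have "restrict s {..2 * n} \<in> hankel_fin q (2 * n)" if "s \<in> stieltjes_nonneg q \<alpha> \<infinity>" for s n
    using stieltjes_infinity_restrict[OF that, of "2 * n"] stieltjes_nonneg_iff[OF q] hankel_fin_iff[OF q] by simp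
  moreover have "s \<in> mat_seqs q \<infinity>" if "s \<in> stieltjes_nonneg q \<alpha> \<infinity>" for s
    using that by (simp add: stieltjes_def)
  ultimately show ?thesis unfolding infinity twice_infinity by (auto simp: hankel_def)
qed

lemma hankel_infinity_subset_first_dom:
  assumes q: "q \<ge> 1"
  shows "hankel q \<infinity> \<subseteq> first_dom q \<infinity>"
proof
  fix s assume "s \<in> hankel q \<infinity>"
  then have s: "s \<in> mat_seqs q \<infinity>" and fin: "\<And>n. restrict s {..2 * n} \<in> hankel_fin q (2 * n)"
    by (auto simp: hankel_def)
  have psd: "hankel_psd q (Suc n) s" for n
    using fin[of n] unfolding hankel_fin_iff[OF q] by (simp add: hankel_psd_restrict)
  have "mat_kernel (s 0) \<subseteq> mat_kernel (s j) \<and>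
      vec_space.col_space q (s j) \<subseteq> vec_space.col_space q (s 0)" for j
    by (rule hankel_psd_dominated[OF psd[of "Suc j"]]) (simp_all add: mat_seqs_carrier[OF s])
  then show "s \<in> first_dom q \<infinity>" using s unfolding first_dom_def by blast
qed

lemma hankel_ext_subset_first_dom:
  assumes q: "q \<ge> 1"
  shows "hankel_ext q \<kappa> \<subseteq> first_dom q \<kappa>"
proof (cases \<kappa>)
  case (enat m)
  show ?thesis
  proof
    fix s assume s_in: "s \<in> hankel_ext q \<kappa>"
    then have s: "s \<in> mat_seqs q (enat m)" by (auto simp: hankel_ext_def enat split: if_splits)
    have "\<exists>n t. hankel_psd q (Suc n) t \<and> m < 2 * n \<and> (\<forall>j\<le>m. t j = s j)"
    proof (cases "even m")
      case True
      then obtain A B where "s(m + 1 := A, m + 2 := B) \<in> hankel_fin q (m + 2)"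
        using s_in by (auto simp: hankel_ext_def enat)
      then have "hankel_psd q (Suc (Suc (m div 2))) (s(m + 1 := A, m + 2 := B))"
        by (simp add: hankel_fin_iff[OF q])
      then show ?thesis
        using True by (intro exI[of _ "Suc (m div 2)"] exI[of _ "s(m + 1 := A, m + 2 := B)"]) auto
    next
      case False
      then obtain A where "s(m + 1 := A) \<in> hankel_fin q (m + 1)"
        using s_in by (auto simp: hankel_ext_def enat)
      then have "hankel_psd q (Suc ((m + 1) div 2)) (s(m + 1 := A))"
        unfolding hankel_fin_iff[OF q] by blast
      then show ?thesis
        using False by (intro exI[of _ "(m + 1) div 2"] exI[of _ "s(m + 1 := A)"]) auto
    qed
    then obtain n t where t: "hankel_psd q (Suc n) t" "m < 2 * n" "\<And>j. j \<le> m \<Longrightarrow> t j = s j" by blast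
    have "mat_kernel (s 0) \<subseteq> mat_kernel (s j) \<and>
        vec_space.col_space q (s j) \<subseteq> vec_space.col_space q (s 0)" if "j \<le> m" for j
      using hankel_psd_dominated[OF t(1), of j] t(2,3) that mat_seqs_carrier[OF s] by simp
    then show "s \<in> first_dom q \<kappa>" using s unfolding first_dom_def enat by simp
  qed
next
  case infinity
  then show ?thesis using hankel_infinity_subset_first_dom[OF q] by (simp add: hankel_ext_def)
qed

lemma first_dom_but_lastI:
  assumes "s \<in> mat_seqs q (enat m)"
    and "\<And>j. j < m \<Longrightarrow> mat_kernel (s 0) \<subseteq> mat_kernel (s j) \<and>
        vec_space.col_space q (s j) \<subseteq> vec_space.col_space q (s 0)"
  shows "s \<in> first_dom_but_last q (enat m)"
proof (cases "m = 0")
  case True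
  then show ?thesis using assms(1) by (simp add: first_dom_but_last_def first_dom_def zero_enat_def)
next
  case False
  then have "restrict s {..m - 1} \<in> mat_seqs q (enat (m - 1))"
    by (intro mat_seqs_restrict[OF assms(1)]) simp
  then show ?thesis using False assms by (auto simp: first_dom_but_last_def first_dom_def)
qed

lemma first_dom_subset_but_last: "first_dom q \<kappa> \<subseteq> first_dom_but_last q \<kappa>"
proof (cases \<kappa>)
  case (enat m)
  then show ?thesis unfolding enat first_dom_def
    by (intro subsetI first_dom_but_lastI) simp_all
qed (simp add: first_dom_but_last_def)

lemma hankel_subset_first_dom_but_last:
  assumes q: "q \<ge> 1"
  shows "hankel q (2 * \<kappa>) \<subseteq> first_dom_but_last q (2 * \<kappa>)"
proof (cases \<kappa>)
  case (enat k)
  have 2: "2 * enat k = enat (2 * k)" by (simp add: numeral_eq_enat)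
  show ?thesis unfolding enat 2
  proof
    fix s assume "s \<in> hankel q (enat (2 * k))"
    then have s: "s \<in> mat_seqs q (enat (2 * k))" and psd: "hankel_psd q (Suc k) s"
      by (auto simp: hankel_def hankel_fin_iff[OF q])
    show "s \<in> first_dom_but_last q (enat (2 * k))"
      by (rule first_dom_but_lastI[OF s], rule hankel_psd_dominated[OF psd])
        (use mat_seqs_carrier[OF s] in auto)
  qed
next
  case infinity
  then show ?thesis using hankel_infinity_subset_first_dom[OF q]
    by (simp add: first_dom_but_last_def twice_infinity)
qed

lemma stieltjes_nonneg_subset_first_dom_but_last:
  assumes q: "q \<ge> 1"
  shows "stieltjes_nonneg q \<alpha> \<kappa> \<subseteq> first_dom_but_last q \<kappa>"
proof (cases "\<exists>\<kappa>'. \<kappa> = 2 * \<kappa>'")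
  case True
  then show ?thesis
    using stieltjes_nonneg_subset_hankel[OF q] hankel_subset_first_dom_but_last[OF q] by blast
next
  case False
  have "\<kappa> \<noteq> \<infinity>" using False twice_infinity by metis
  then obtain m where m: "\<kappa> = enat m" by auto
  have "odd m"
  proof
    assume "even m"
    then have "\<kappa> = 2 * enat (m div 2)" by (simp add: m numeral_eq_enat)
    with False show False by blast
  qed
  then obtain n where n: "m = 2 * n + 1" by (elim oddE)
  show ?thesis
  proof
    fix s assume "s \<in> stieltjes_nonneg q \<alpha> \<kappa>"
    then have s: "s \<in> mat_seqs q (enat m)" and psd: "hankel_psd q (Suc n) s" "hankel_psd q (Suc n) (shift_seq \<alpha> s)"
      using stieltjes_nonneg_iff[OF q, of s \<alpha> m] by (auto simp: m n)
    have "mat_kernel (s 0) \<subseteq> mat_kernel (s j) \<and>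
        vec_space.col_space q (s j) \<subseteq> vec_space.col_space q (s 0)" if "j < m" for j
      by (rule stieltjes_psd_dominated[OF _ psd]) (use mat_seqs_carrier[OF s] that n in auto)
    then show "s \<in> first_dom_but_last q \<kappa>" unfolding m by (rule first_dom_but_lastI[OF s])
  qed
qed

lemma stieltjes_ext_subset_nonneg:
  assumes q: "q \<ge> 1"
  shows "stieltjes_ext q \<alpha> \<kappa> \<subseteq> stieltjes_nonneg q \<alpha> \<kappa>"
proof (cases \<kappa>)
  case (enat m)
  show ?thesis unfolding enat
  proof
    fix s assume "s \<in> stieltjes_ext q \<alpha> (enat m)"
    then obtain A where s: "s \<in> mat_seqs q (enat m)"
      and psd: "hankel_psd q (Suc (Suc m div 2)) (s(m + 1 := A))"
        "hankel_psd q (Suc (Suc m) div 2) (shift_seq \<alpha> (s(m + 1 := A)))"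
      by (auto simp: stieltjes_ext_def stieltjes_nonneg_iff[OF q])
    have "hankel_psd q (Suc (m div 2)) s"
      by (rule hankel_psd_cong[THEN iffD1, OF _ hankel_psd_mono[OF psd(1)]]) auto
    moreover have "hankel_psd q (Suc m div 2) (shift_seq \<alpha> s)"
      by (rule hankel_psd_cong[THEN iffD1, OF _ hankel_psd_mono[OF psd(2)]]) (auto simp: shift_seq_def)
    ultimately show "s \<in> stieltjes_nonneg q \<alpha> (enat m)"
      using s by (simp add: stieltjes_nonneg_iff[OF q])
  qed
qed (simp add: stieltjes_ext_def)

lemma stieltjes_ext_subset_hankel_ext:
  assumes q: "q \<ge> 1"
  shows "stieltjes_ext q \<alpha> \<kappa> \<subseteq> hankel_ext q \<kappa>"
proof (cases \<kappa>)
  case (enat m)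
  show ?thesis unfolding enat
  proof
    fix s assume "s \<in> stieltjes_ext q \<alpha> (enat m)"
    then obtain C where s: "s \<in> mat_seqs q (enat m)" and C: "C \<in> carrier_mat q q"
      and t: "s(m + 1 := C) \<in> mat_seqs q (enat (m + 1))"
      and psd: "hankel_psd q (Suc (Suc m div 2)) (s(m + 1 := C))"
        "hankel_psd q (Suc (Suc m) div 2) (shift_seq \<alpha> (s(m + 1 := C)))"
      by (auto simp: stieltjes_ext_def stieltjes_nonneg_iff[OF q])
    show "s \<in> hankel_ext q (enat m)"
    proof (cases "even m")
      case True
      then obtain n where m: "m = 2 * n" by (elim evenE)
      have "hankel_psd q (Suc n) (s(m + 1 := C))" using psd(1) by (simp add: m)
      then have psd': "hankel_psd q (Suc n) s"
        by (rule hankel_psd_cong[THEN iffD1, rotated]) (simp add: m)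
      obtain A B where AB: "A \<in> carrier_mat q q" "B \<in> carrier_mat q q"
          "hankel_psd q (Suc (Suc n)) (s(2 * n + 1 := A, 2 * n + 2 := B))"
        by (rule hankel_extend_of_stieltjes[OF _ C psd', of \<alpha>])
          (use mat_seqs_carrier[OF s] psd(2) m in auto)
      have "s(m + 1 := A, m + 2 := B) \<in> mat_seqs q (enat (m + 2))"
        using mat_seqs_upd[OF mat_seqs_upd[OF s AB(1)] AB(2)] by simp
      then have "s(m + 1 := A, m + 2 := B) \<in> hankel_fin q (m + 2)"
        using AB(3) m by (simp add: hankel_fin_iff[OF q])
      then show ?thesis using True s AB(1,2) by (auto simp: hankel_ext_def)
    next
      case False
      then have "s(m + 1 := C) \<in> hankel_fin q (m + 1)"
        using t psd(1) by (simp add: hankel_fin_iff[OF q])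
      then show ?thesis using False s C by (auto simp: hankel_ext_def)
    qed
  qed
next
  case infinity
  then show ?thesis
    using stieltjes_nonneg_subset_hankel[OF q, of \<alpha> \<infinity>]
    by (simp add: stieltjes_ext_def hankel_ext_def twice_infinity)
qed

lemma stieltjes_extI_even:
  assumes q: "q \<ge> 1" and s: "s \<in> stieltjes_nonneg q \<alpha> (enat (2 * n))"
    and dep: "hankel_col_dep q n n (shift_seq \<alpha> s)"
  shows "s \<in> stieltjes_ext q \<alpha> (enat (2 * n))"
proof -
  have seq: "s \<in> mat_seqs q (enat (2 * n))"
    and psd: "hankel_psd q (Suc n) s" "hankel_psd q n (shift_seq \<alpha> s)"
    using s by (auto simp: stieltjes_nonneg_iff[OF q])
  obtain A where A: "A \<in> carrier_mat q q" "hankel_psd q (Suc n) (s(2 * n + 1 := A))"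
      "hankel_psd q (Suc n) (shift_seq \<alpha> (s(2 * n + 1 := A)))"
    by (rule stieltjes_extend_even[OF _ psd dep]) (use mat_seqs_carrier[OF seq] in auto)
  have "s(2 * n + 1 := A) \<in> stieltjes_nonneg q \<alpha> (enat (2 * n + 1))"
    using A mat_seqs_upd[OF seq A(1)] by (simp add: stieltjes_nonneg_iff[OF q])
  then show ?thesis using seq A(1) by (auto simp: stieltjes_ext_def)
qed

lemma stieltjes_extI_odd:
  assumes q: "q \<ge> 1" and s: "s \<in> stieltjes_nonneg q \<alpha> (enat (2 * n + 1))"
    and dep: "hankel_col_dep q (Suc n) (Suc n) s"
  shows "s \<in> stieltjes_ext q \<alpha> (enat (2 * n + 1))"
proof -
  have seq: "s \<in> mat_seqs q (enat (2 * n + 1))"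
    and psd: "hankel_psd q (Suc n) s" "hankel_psd q (Suc n) (shift_seq \<alpha> s)"
    using s by (auto simp: stieltjes_nonneg_iff[OF q])
  obtain A where A: "A \<in> carrier_mat q q" "hankel_psd q (Suc (Suc n)) (s(2 * n + 2 := A))"
    by (rule stieltjes_extend_odd[OF _ psd dep]) (use mat_seqs_carrier[OF seq] in auto)
  have "hankel_psd q (Suc n) (shift_seq \<alpha> (s(2 * n + 2 := A)))"
    by (rule hankel_psd_cong[THEN iffD1, OF _ psd(2)]) (simp add: shift_seq_upd)
  then have "s(2 * n + 1 + 1 := A) \<in> stieltjes_nonneg q \<alpha> (enat (2 * n + 1 + 1))"
    using A mat_seqs_upd[OF seq A(1)] by (simp add: stieltjes_nonneg_iff[OF q])
  then show ?thesis using seq A(1) by (auto simp: stieltjes_ext_def)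
qed

lemma stieltjes_pos_subset_nonneg: "stieltjes_pos q \<alpha> \<kappa> \<subseteq> stieltjes_nonneg q \<alpha> \<kappa>"
proof -
  have "stieltjes_fin pos_hermitian q \<alpha> m \<subseteq> stieltjes_fin nonneg_hermitian q \<alpha> m" for m
    using pos_hermitian_imp_nonneg by (auto simp: stieltjes_fin_def)
  then show ?thesis by (cases \<kappa>) (auto simp: stieltjes_def)
qed

text \<open>Positive definite matrices are invertible, which gives the range condition of either
  parity.\<close>

lemma stieltjes_pos_subset_ext:
  assumes q: "q \<ge> 1"
  shows "stieltjes_pos q \<alpha> \<kappa> \<subseteq> stieltjes_ext q \<alpha> \<kappa>"
proof (cases \<kappa>)
  case (enat m)
  show ?thesis unfolding enat
  proof
    fix s assume s: "s \<in> stieltjes_pos q \<alpha> (enat m)"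
    then have s': "s \<in> stieltjes_nonneg q \<alpha> (enat m)" using stieltjes_pos_subset_nonneg by blast
    have seq: "s \<in> mat_seqs q (enat m)" using s by (simp add: stieltjes_def stieltjes_fin_def)
    have pos: "pos_hermitian (block_hankel q s (m div 2))"
      "m \<ge> 1 \<Longrightarrow> pos_hermitian (block_hankel q (shift_seq \<alpha> s) ((m - 1) div 2))"
      using s by (simp_all add: stieltjes_def stieltjes_fin_iff[OF seq])
    show "s \<in> stieltjes_ext q \<alpha> (enat m)"
    proof (cases "even m")
      case True
      then obtain n where m: "m = 2 * n" by (elim evenE)
      have "hankel_col_dep q n n (shift_seq \<alpha> s)"
      proof (cases n)
        case (Suc k)
        then have "(m - 1) div 2 = k" by (simp add: m)
        then show ?thesis using hankel_col_dep_pos[OF q pos(2)] Suc m by simp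
      qed (simp add: hankel_col_dep_def)
      then show ?thesis using stieltjes_extI_even[OF q] s' by (simp add: m)
    next
      case False
      then obtain n where m: "m = 2 * n + 1" by (elim oddE)
      then show ?thesis using stieltjes_extI_odd[OF q] s' hankel_col_dep_pos[OF q pos(1)] by simp
    qed
  qed
next
  case infinity
  then show ?thesis using stieltjes_pos_subset_nonneg by (simp add: stieltjes_ext_def)
qed

text \<open>A vanishing Schur complement gives a column relation in one block row more than there are
  columns, for \<open>s\<close> or for the shifted sequence. This surplus row lets the relation pass to the other
  sequence, which is the one to be extended.\<close>

lemma stieltjes_cd_subset_ext:
  assumes q: "q \<ge> 1"
  shows "stieltjes_cd q \<alpha> \<kappa> \<subseteq> stieltjes_ext q \<alpha> \<kappa>"
proof (cases \<kappa>)
  case (enat m)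
  show ?thesis unfolding enat
  proof
    fix s assume "s \<in> stieltjes_cd q \<alpha> (enat m)"
    then have s: "s \<in> stieltjes_nonneg q \<alpha> (enat m)"
      and schur: "hankel_schur q (if even m then s else shift_seq \<alpha> s) (m div 2) = 0\<^sub>m q q"
      by (auto simp: stieltjes_cd_def stieltjes_cd_fin_def)
    then have seq: "s \<in> mat_seqs q (enat m)"
      and psd: "hankel_psd q (Suc (m div 2)) s" "hankel_psd q (Suc m div 2) (shift_seq \<alpha> s)"
      by (auto simp: stieltjes_nonneg_iff[OF q])
    have car: "s j \<in> carrier_mat q q" if "j \<le> m" for j using mat_seqs_carrier[OF seq] that by simp
    show "s \<in> stieltjes_ext q \<alpha> (enat m)"
    proof (cases "even m")
      case True
      then obtain n where m: "m = 2 * n" by (elim evenE)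
      have "hankel_col_dep q n (Suc n) s"
        by (rule hankel_col_dep_schur_0[OF q]) (use psd schur car m in auto)
      then have "hankel_col_dep q n n (shift_seq \<alpha> s)"
        by (rule hankel_col_dep_shift[rotated]) (use car m in auto)
      then show ?thesis using stieltjes_extI_even[OF q] s by (simp add: m)
    next
      case False
      then obtain n where m: "m = 2 * n + 1" by (elim oddE)
      have "hankel_col_dep q n (Suc n) (shift_seq \<alpha> s)"
        by (rule hankel_col_dep_schur_0[OF q]) (use psd schur car m in \<open>auto simp: shift_seq_def\<close>)
      then have "hankel_col_dep q (Suc n) (Suc n) s"
        by (rule hankel_col_dep_unshift[rotated]) (use car m in auto)
      then show ?thesis using stieltjes_extI_odd[OF q] s by (simp add: m)
    qed
  qed
qed (auto simp: stieltjes_cd_def stieltjes_ext_def)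

theorem proposition3p8:
  fixes q :: nat and \<alpha> :: real and \<kappa> :: enat
  assumes "q \<ge> 1"
  shows
    "(stieltjes_ext q \<alpha> \<kappa> \<subseteq> hankel_ext q \<kappa> \<and>
      hankel_ext q \<kappa> \<subseteq> first_dom q \<kappa> \<and>
      first_dom q \<kappa> \<subseteq> first_dom_but_last q \<kappa>) \<and>
     (stieltjes_nonneg q \<alpha> (2 * \<kappa>) \<subseteq> hankel q (2 * \<kappa>) \<and>
      hankel q (2 * \<kappa>) \<subseteq> first_dom_but_last q (2 * \<kappa>)) \<and>
     (stieltjes_ext q \<alpha> \<kappa> \<subseteq> stieltjes_nonneg q \<alpha> \<kappa> \<and>
      stieltjes_nonneg q \<alpha> \<kappa> \<subseteq> first_dom_but_last q \<kappa>) \<and>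
     (stieltjes_pos q \<alpha> \<kappa> \<union> stieltjes_cd q \<alpha> \<kappa> \<subseteq> stieltjes_ext q \<alpha> \<kappa>)"
  using stieltjes_ext_subset_hankel_ext[OF assms] hankel_ext_subset_first_dom[OF assms]
    first_dom_subset_but_last stieltjes_nonneg_subset_hankel[OF assms]
    hankel_subset_first_dom_but_last[OF assms] stieltjes_ext_subset_nonneg[OF assms]
    stieltjes_nonneg_subset_first_dom_but_last[OF assms] stieltjes_pos_subset_ext[OF assms]
    stieltjes_cd_subset_ext[OF assms]
  by (simp add: Un_least)

end
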